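(* Let $\mathbb X,\mathbb Y$ be Euclidean spaces, $g\colon\mathbb X\to\mathbb Y$ twice continuously differentiable, $D\subset\mathbb Y$ closed, and $\Phi(x):=g(x)-D$. Let $(\bar x,0)\in\operatorname{gph}\Phi$, $u\in\mathbb S_{\mathbb X}$, and $x^*\in\widetilde D^*_2\Phi((\bar x,0);(u,v))(y^* )$ for some $v,y^*\in\mathbb Y$. Then there exists $z^*\in\mathbb Y$ such that (a) $x^*=\nabla^2\langle y^*,g\rangle(\bar x)(u)+\nabla g(\bar x)^*z^*$ and (b) $y^*\in\mathcal N_D(g(\bar x);\nabla g(\bar x)u-v)\cap\ker\nabla g(\bar x)^*$. Moreover: (i) If either $D\mathcal N_D(g(\bar x),y^* )(0)\cap\ker\nabla g(\bar x)^*=\{0\}$, or [$\nabla g(\bar x)u\neq v$ and $D_{\mathrm{sub}}\mathcal N_D(g(\bar x),y^* )\big((\nabla g(\bar x)u-v)/\|\nabla g(\bar x)u-v\|\big)\cap\ker\nabla g(\bar x)^*=\emptyset$], then one can find $z^*\in D\mathcal N_D(g(\bar x),y^* )(\nabla g(\bar x)u-v)$ satisfying (a) and (b). (ii) If $\mathbb Y=\mathbb R^m$ and $D$ is locally polyhedral around $g(\bar x)$, then $\mathcal N_D(g(\bar x);\nabla g(\bar x)u-v)=\mathcal N_{\mathcal T_D(g(\bar x))}(\nabla g(\bar x)u-v)$, and there are $z_1^*,z_2^*\in\mathbb R^m$ each satisfying (a) and (b) (with $z^*=z_i^*$) such that $z_1^*\in\mathcal N_{\mathcal T_D(g(\bar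 x))}(\nabla g(\bar x)u-v)$ and $z_2^*\in\mathcal T_{\mathcal N_{\mathcal T_D(g(\bar x))}(\nabla g(\bar x)u-v)}(y^* )$.
   Context: $\mathbb S_{\mathbb X}$ is the unit sphere. $\nabla g(\bar x)\colon\mathbb X\to\mathbb Y$ is the derivative, $\nabla g(\bar x)^*$ its adjoint; $\nabla^2\langle y^*,g\rangle(\bar x)(u)\in\mathbb X$ denotes the Hessian of $x\mapsto\langle y^*,g(x)\rangle$ at $\bar x$ applied to $u$. $\mathcal T_Q$, $\widehat{\mathcal N}_Q$, $\mathcal N_Q$ denote the tangent, regular normal and limiting normal cones; $\mathcal N_Q(x;w)$ is the directional limiting normal cone: all $\eta$ with $w_k\to w$, $t_k\downarrow0$, $\eta_k\to\eta$, $\eta_k\in\widehat{\mathcal N}_Q(x+t_kw_k)$. Gfrerer's pseudo-coderivative of order $2$: $x^*\in\widetilde D^*_2\Phi((\bar x,0);(u,v))(y^* )$ iff there are $u_k\to u$, $v_k\to v$, $t_k\downarrow 0$, $x_k^*\to x^*$, $y_k^*\to y^*$ with $(x_k^*,-y_k^*/(t_k\|u_k\|))\in\widehat{\mathcal N}_{\operatorname{gph}\Phi}(\bar x+t_ku_k,t_kv_k)$ for all $k$. For $(\bar y,\bar y^* )\in\operatorname{gph}\mathcal N_D$: the graphical derivative $D\mathcal N_D(\bar y,\bar y^* )$ has graph $\mathcal T_{\operatorname{gph}\mathcal N_D}(\bar y,\bar y^* )$; the graphical subderivative $D_{\mathrm{sub}}\mathcal N_D(\bar y,\bar y^* )\colon\mathbb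 S_{\mathbb Y}\rightrightarrows\mathbb S_{\mathbb Y}$ assigns to $w\in\mathbb S_{\mathbb Y}$ all $q\in\mathbb S_{\mathbb Y}$ such that there are $w_k\to w$, $q_k\to q$, $t_k\downarrow0$, $\tau_k\downarrow0$ with $\tau_k/t_k\to\infty$ and $\bar y^*+\tau_kq_k\in\mathcal N_D(\bar y+t_kw_k)$. A set $D\subset\mathbb R^m$ is locally polyhedral around $y\in D$ if its intersection with some box around $y$ is a finite union of convex polyhedra. *)

theory Defs
  imports "HOL-Analysis.Analysis"
begin

definition tan_cone :: "'c::euclidean_space set \<Rightarrow> 'c \<Rightarrow> 'c set" where
  "tan_cone Q x = {w. \<exists>(t::nat \<Rightarrow> real) wk.
      (\<forall>k. t k > 0) \<and> t \<longlonglongrightarrow> 0 \<and> wk \<longlonglongrightarrow> w \<and> (\<forall>k. x + t k *\<^sub>R wk k \<in> Q)}"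

definition reg_normal_cone :: "'c::euclidean_space set \<Rightarrow> 'c \<Rightarrow> 'c set" where
  "reg_normal_cone Q x = {\<eta>. x \<in> Q \<and>
      (\<forall>\<epsilon>>0. \<exists>\<delta>>0. \<forall>x'\<in>Q. dist x' x < \<delta> \<longrightarrow> \<eta> \<bullet> (x' - x) \<le> \<epsilon> * norm (x' - x))}"

definition lim_normal_cone :: "'c::euclidean_space set \<Rightarrow> 'c \<Rightarrow> 'c set" where
  "lim_normal_cone Q x = {\<eta>. \<exists>xk \<eta>k. xk \<longlonglongrightarrow> x \<and> \<eta>k \<longlonglongrightarrow> \<eta> \<and> (\<forall>k. xk k \<in> Q) \<and>
      (\<forall>k. \<eta>k k \<in> reg_normal_cone Q (xk k))}"

definition dir_normal_cone :: "'c::euclidean_space set \<Rightarrow> 'c \<Rightarrow> 'c \<Rightarrow> 'c set" where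
  "dir_normal_cone Q x w = {\<eta>. \<exists>(t::nat \<Rightarrow> real) wk \<eta>k.
      (\<forall>k. t k > 0) \<and> t \<longlonglongrightarrow> 0 \<and> wk \<longlonglongrightarrow> w \<and> \<eta>k \<longlonglongrightarrow> \<eta> \<and>
      (\<forall>k. \<eta>k k \<in> reg_normal_cone Q (x + t k *\<^sub>R wk k))}"

text \<open>Gfrerer's pseudo-coderivative of order 2 of a set-valued map given by its graph G,
  at the point (xb, yb) of the graph in direction (u, v), applied to ys.\<close>
definition pseudo_coderiv2 ::
  "('a::euclidean_space \<times> 'b::euclidean_space) set \<Rightarrow> 'a \<times> 'b \<Rightarrow> 'a \<times> 'b \<Rightarrow> 'b \<Rightarrow> 'a set" where
  "pseudo_coderiv2 G p d ys = {xs. \<exists>uk vk (t::nat \<Rightarrow> real) xk yk.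
      uk \<longlonglongrightarrow> fst d \<and> vk \<longlonglongrightarrow> snd d \<and> (\<forall>k. t k > 0) \<and> t \<longlonglongrightarrow> 0 \<and>
      xk \<longlonglongrightarrow> xs \<and> yk \<longlonglongrightarrow> ys \<and>
      (\<forall>k. (xk k, - ((1 / (t k * norm (uk k))) *\<^sub>R yk k)) \<in>
             reg_normal_cone G (fst p + t k *\<^sub>R uk k, snd p + t k *\<^sub>R vk k))}"

definition gph_normal :: "'c::euclidean_space set \<Rightarrow> ('c \<times> 'c) set" where
  "gph_normal D = {(y, \<eta>). \<eta> \<in> lim_normal_cone D y}"

definition graph_deriv_normal :: "'c::euclidean_space set \<Rightarrow> 'c \<Rightarrow> 'c \<Rightarrow> 'c \<Rightarrow> 'c set" where
  "graph_deriv_normal D yb ys w = {q. (w, q) \<in> tan_cone (gph_normal D) (yb, ys)}"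

text \<open>Graphical subderivative D_sub N_D(yb, ys)(w) for w on the unit sphere.\<close>
definition graph_subderiv_normal :: "'c::euclidean_space set \<Rightarrow> 'c \<Rightarrow> 'c \<Rightarrow> 'c \<Rightarrow> 'c set" where
  "graph_subderiv_normal D yb ys w = {q. q \<in> sphere 0 1 \<and>
      (\<exists>wk qk (t::nat \<Rightarrow> real) \<tau>. wk \<longlonglongrightarrow> w \<and> qk \<longlonglongrightarrow> q \<and>
        (\<forall>k. t k > 0) \<and> t \<longlonglongrightarrow> 0 \<and> (\<forall>k. \<tau> k > 0) \<and> \<tau> \<longlonglongrightarrow> 0 \<and>
        filterlim (\<lambda>k. \<tau> k / t k) at_top sequentially \<and>
        (\<forall>k. ys + \<tau> k *\<^sub>R qk k \<in> lim_normal_cone D (yb + t k *\<^sub>R wk k)))}"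

definition locally_polyhedral :: "'c::euclidean_space set \<Rightarrow> 'c \<Rightarrow> bool" where
  "locally_polyhedral D y \<longleftrightarrow> y \<in> D \<and> (\<exists>a b. y \<in> box a b \<and>
      (\<exists>P. finite P \<and> (\<forall>S\<in>P. polyhedron S) \<and> D \<inter> cbox a b = \<Union>P))"

end

theory Submission
  imports Defs
begin

text \<open>
  A regular normal to the graph of \<open>g - D\<close> at \<open>(x, y)\<close> is a pair \<open>(\<nabla>g(x)\<^sup>* \<eta>, -\<eta>)\<close> with \<open>\<eta>\<close>
  a regular normal to \<open>D\<close> at \<open>g x - y\<close>. Applied along the sequences defining the
  pseudo-coderivative, this gives \<open>yk \<rightarrow> ys\<close> with \<open>yk\<close> normal to \<open>D\<close> at \<open>g xb + t wk\<close>, and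
  a first order expansion of \<open>\<nabla>g\<close> at \<open>xb\<close> shows that \<open>\<nabla>g(xb)\<^sup>*\<close> kills \<open>ys\<close> and maps \<open>yk / t\<close>,
  equivalently \<open>(yk - ys) / t\<close>, to a sequence converging to \<open>xs - hess\<close>.
  What remains is to pass to the limit in the argument of \<open>\<nabla>g(xb)\<^sup>*\<close>. In general its range is
  closed; under the qualification conditions \<open>(yk - ys) / t\<close> has a bounded subsequence;
  in the polyhedral case \<open>yk\<close> can be taken in one fixed finitely generated cone,
  and linear images of such cones are closed.
\<close>

subsection \<open>Regular normals and the pseudo-coderivative\<close>

text \<open>Frechet differentiability controls the remainder uniformly over bounded directions, so
  the direction may vary along the sequence. This serves twice: for \<open>g\<close>, to find the
  limit direction in the image space, and for its derivative, to produce the second order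
  term.\<close>

lemma has_derivative_directional_sequence:
  fixes f :: "'a::real_normed_vector \<Rightarrow> 'b::real_normed_vector" and t :: "nat \<Rightarrow> real"
  assumes f: "(f has_derivative A) (at x)"
    and t: "\<And>k. t k > 0" "t \<longlonglongrightarrow> 0" and u: "uk \<longlonglongrightarrow> u"
  shows "(\<lambda>k. (f (x + t k *\<^sub>R uk k) - f x) /\<^sub>R t k) \<longlonglongrightarrow> A u"
proof -
  have bl: "bounded_linear A" and
    alt: "\<And>e. e > 0 \<Longrightarrow> \<exists>d>0. \<forall>y. norm (y - x) < d \<longrightarrow> norm (f y - f x - A (y - x)) \<le> e * norm (y - x)"
    using f unfolding has_derivative_at_alt by auto
  interpret A: bounded_linear A by (rule bl)
  obtain M where M: "M > 0" "\<And>k. norm (uk k) \<le> M"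
    using convergent_imp_Bseq[of uk] u unfolding convergent_def Bseq_def by auto
  let ?q = "\<lambda>k. (f (x + t k *\<^sub>R uk k) - f x) /\<^sub>R t k"
  have tu: "(\<lambda>k. t k *\<^sub>R uk k) \<longlonglongrightarrow> 0"
    using tendsto_scaleR[OF t(2) u] by simp
  have "(\<lambda>k. ?q k - A (uk k)) \<longlonglongrightarrow> 0"
  proof (rule LIMSEQ_I)
    fix r :: real assume r: "r > 0"
    define e where "e = r / (2 * M)"
    have e: "e > 0" using r M by (simp add: e_def)
    obtain d where d: "d > 0" "\<And>y. norm (y - x) < d \<Longrightarrow> norm (f y - f x - A (y - x)) \<le> e * norm (y - x)"
      using alt[OF e] by blast
    obtain N where N: "\<And>k. k \<ge> N \<Longrightarrow> norm (t k *\<^sub>R uk k) < d"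
      using LIMSEQ_D[OF tu d(1)] by auto
    show "\<exists>no. \<forall>n\<ge>no. norm (?q n - A (uk n) - 0) < r"
    proof (intro exI allI impI)
      fix n assume n: "N \<le> n"
      have "?q n - A (uk n) = (f (x + t n *\<^sub>R uk n) - f x - A (t n *\<^sub>R uk n)) /\<^sub>R t n"
        using t(1)[of n] by (simp add: A.scaleR scaleR_diff_right)
      then have "norm (?q n - A (uk n)) = norm (f (x + t n *\<^sub>R uk n) - f x - A (t n *\<^sub>R uk n)) / t n"
        using t(1)[of n] by (simp add: divide_inverse mult.commute)
      also have "\<dots> \<le> (e * norm (t n *\<^sub>R uk n)) / t n"
        using d(2)[of "x + t n *\<^sub>R uk n"] N[OF n] t(1)[of n] by (intro divide_right_mono) auto
      also have "\<dots> = e * norm (uk n)"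
        using t(1)[of n] by simp
      also have "\<dots> \<le> e * M" using M(2)[of n] e by (simp add: mult_left_mono)
      also have "\<dots> < r" using r M by (simp add: e_def)
      finally show "norm (?q n - A (uk n) - 0) < r" by simp
    qed
  qed
  from tendsto_add[OF this A.tendsto[OF u]] show ?thesis by simp
qed

lemma reg_normal_cone_scaleR:
  assumes "\<eta> \<in> reg_normal_cone Q x" "c > 0"
  shows "c *\<^sub>R \<eta> \<in> reg_normal_cone Q x"
proof -
  have "\<exists>\<delta>>0. \<forall>x'\<in>Q. dist x' x < \<delta> \<longrightarrow> (c *\<^sub>R \<eta>) \<bullet> (x' - x) \<le> \<epsilon> * norm (x' - x)"
    if e: "\<epsilon> > 0" for \<epsilon>
  proof -
    have "\<epsilon> / c > 0" using e assms by simp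
    then obtain \<delta> where d: "\<delta> > 0" "\<And>x'. x' \<in> Q \<Longrightarrow> dist x' x < \<delta> \<Longrightarrow> \<eta> \<bullet> (x' - x) \<le> \<epsilon> / c * norm (x' - x)"
      using assms unfolding reg_normal_cone_def by blast
    show ?thesis
    proof (intro exI conjI ballI impI)
      fix x' assume "x' \<in> Q" "dist x' x < \<delta>"
      then show "(c *\<^sub>R \<eta>) \<bullet> (x' - x) \<le> \<epsilon> * norm (x' - x)"
        using d(2)[of x'] assms(2) by (simp add: field_simps)
    qed (rule d(1))
  qed
  then show ?thesis using assms unfolding reg_normal_cone_def by auto
qed

lemma reg_normal_cone_subset_lim_normal_cone:
  "reg_normal_cone Q x \<subseteq> lim_normal_cone Q x"
proof
  fix \<eta> assume \<eta>: "\<eta> \<in> reg_normal_cone Q x"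
  then have "x \<in> Q" by (simp add: reg_normal_cone_def)
  with \<eta> show "\<eta> \<in> lim_normal_cone Q x"
    unfolding lim_normal_cone_def
    by (intro CollectI exI[of _ "\<lambda>_. x"] exI[of _ "\<lambda>_. \<eta>"]) auto
qed

text \<open>Two families of test points suffice. Keeping \<open>x\<close> fixed and varying the
  point of \<open>D\<close> gives the normal inequality for \<open>\<eta>\<close>. Keeping
  \<open>d\<close> fixed and moving along \<open>x + s n *\<^sub>R h\<close> gives an inequality
  between two linear forms in \<open>h\<close>, and replacing \<open>h\<close> by \<open>- h\<close>
  turns it into an equality.\<close>

lemma reg_normal_cone_graph_diff:
  fixes g :: "'a::euclidean_space \<Rightarrow> 'b::euclidean_space"
  assumes der: "(g has_derivative A) (at x)"
    and N: "(\<xi>, - \<eta>) \<in> reg_normal_cone {(x, y). y \<in> (\<lambda>d. g x - d) ` D} (x, y)"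
  shows "\<eta> \<in> reg_normal_cone D (g x - y)" "\<And>h. \<xi> \<bullet> h = \<eta> \<bullet> A h"
proof -
  let ?G = "{(x, y). y \<in> (\<lambda>d. g x - d) ` D}"
  obtain d where d: "d \<in> D" "y = g x - d"
    using N unfolding reg_normal_cone_def by auto
  have dd: "g x - y = d" using d by simp
  have ineq: "\<exists>\<delta>>0. \<forall>x' d'. d' \<in> D \<longrightarrow> norm (x' - x, (g x' - d') - (g x - d)) < \<delta> \<longrightarrow>
      \<xi> \<bullet> (x' - x) - \<eta> \<bullet> ((g x' - d') - (g x - d)) \<le> \<epsilon> * norm (x' - x, (g x' - d') - (g x - d))"
    if "\<epsilon> > 0" for \<epsilon>
  proof -
    obtain \<delta> where \<delta>: "\<delta> > 0" "\<And>p. p \<in> ?G \<Longrightarrow> dist p (x, y) < \<delta> \<Longrightarrow>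
        (\<xi>, - \<eta>) \<bullet> (p - (x, y)) \<le> \<epsilon> * norm (p - (x, y))"
      using N \<open>\<epsilon> > 0\<close> unfolding reg_normal_cone_def by blast
    show ?thesis
    proof (intro exI conjI allI impI)
      fix x' d' assume "d' \<in> D" "norm (x' - x, (g x' - d') - (g x - d)) < \<delta>"
      then show "\<xi> \<bullet> (x' - x) - \<eta> \<bullet> ((g x' - d') - (g x - d)) \<le> \<epsilon> * norm (x' - x, (g x' - d') - (g x - d))"
        using \<delta>(2)[of "(x', g x' - d')"] d by (auto simp: dist_norm inner_diff_left)
    qed (rule \<delta>(1))
  qed
  have "\<exists>\<delta>>0. \<forall>x'\<in>D. dist x' d < \<delta> \<longrightarrow> \<eta> \<bullet> (x' - d) \<le> \<epsilon> * norm (x' - d)" if "\<epsilon> > 0" for \<epsilon>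
  proof -
    obtain \<delta> where \<delta>: "\<delta> > 0" "\<And>x' d'. d' \<in> D \<Longrightarrow> norm (x' - x, (g x' - d') - (g x - d)) < \<delta> \<Longrightarrow>
      \<xi> \<bullet> (x' - x) - \<eta> \<bullet> ((g x' - d') - (g x - d)) \<le> \<epsilon> * norm (x' - x, (g x' - d') - (g x - d))"
      using ineq[OF \<open>\<epsilon> > 0\<close>] by blast
    show ?thesis
    proof (intro exI conjI ballI impI)
      fix d' assume "d' \<in> D" "dist d' d < \<delta>"
      then show "\<eta> \<bullet> (d' - d) \<le> \<epsilon> * norm (d' - d)"
        using \<delta>(2)[of d' x]
        by (simp add: norm_Pair dist_norm norm_minus_commute inner_diff_right)
    qed (rule \<delta>(1))
  qed
  then show "\<eta> \<in> reg_normal_cone D (g x - y)"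
    unfolding dd reg_normal_cone_def using d by auto
  have le: "\<xi> \<bullet> h - \<eta> \<bullet> A h \<le> 0" for h
  proof -
    define s :: "nat \<Rightarrow> real" where "s n = inverse (real (Suc n))" for n
    have s: "\<And>n. s n > 0" "s \<longlonglongrightarrow> 0"
      unfolding s_def using LIMSEQ_inverse_real_of_nat by auto
    define \<phi> where "\<phi> n = (g (x + s n *\<^sub>R h) - g x) /\<^sub>R s n" for n
    have \<phi>: "\<phi> \<longlonglongrightarrow> A h"
      unfolding \<phi>_def by (rule has_derivative_directional_sequence[OF der s tendsto_const])
    have g\<phi>: "g (x + s n *\<^sub>R h) - g x = s n *\<^sub>R \<phi> n" for n
      using s(1)[of n] by (simp add: \<phi>_def)
    have "\<xi> \<bullet> h - \<eta> \<bullet> A h \<le> \<epsilon> * norm (h, A h)" if "\<epsilon> > 0" for \<epsilon>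
    proof -
      obtain \<delta> where \<delta>: "\<delta> > 0" "\<And>x' d'. d' \<in> D \<Longrightarrow> norm (x' - x, (g x' - d') - (g x - d)) < \<delta> \<Longrightarrow>
        \<xi> \<bullet> (x' - x) - \<eta> \<bullet> ((g x' - d') - (g x - d)) \<le> \<epsilon> * norm (x' - x, (g x' - d') - (g x - d))"
        using ineq[OF \<open>\<epsilon> > 0\<close>] by blast
      have "(\<lambda>n. norm (s n *\<^sub>R (h, \<phi> n))) \<longlonglongrightarrow> norm (0 *\<^sub>R (h, A h))"
        by (intro tendsto_intros s \<phi>)
      then have "eventually (\<lambda>n. norm (s n *\<^sub>R (h, \<phi> n)) < \<delta>) sequentially"
        using \<delta>(1) by (intro order_tendstoD) auto
      then have "eventually (\<lambda>n. \<xi> \<bullet> h - \<eta> \<bullet> \<phi> n \<le> \<epsilon> * norm (h, \<phi> n)) sequentially"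
      proof (eventually_elim)
        case (elim n)
        have eq: "(s n *\<^sub>R h, (g (x + s n *\<^sub>R h) - d) - (g x - d)) = s n *\<^sub>R (h, \<phi> n)"
          using g\<phi>[of n] by (simp add: algebra_simps)
        have "\<xi> \<bullet> (s n *\<^sub>R h) - \<eta> \<bullet> (s n *\<^sub>R \<phi> n) \<le> \<epsilon> * norm (s n *\<^sub>R (h, \<phi> n))"
          using \<delta>(2)[OF d(1), of "x + s n *\<^sub>R h"] elim eq g\<phi>[of n] by simp
        then have "s n * (\<xi> \<bullet> h - \<eta> \<bullet> \<phi> n) \<le> s n * (\<epsilon> * norm (h, \<phi> n))"
          using s(1)[of n] unfolding norm_scaleR by (simp add: algebra_simps)
        then show ?case using s(1)[of n] by simp
      qed
      moreover have "(\<lambda>n. \<xi> \<bullet> h - \<eta> \<bullet> \<phi> n) \<longlonglongrightarrow> \<xi> \<bullet> h - \<eta> \<bullet> A h"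
        by (intro tendsto_intros \<phi>)
      moreover have "(\<lambda>n. \<epsilon> * norm (h, \<phi> n)) \<longlonglongrightarrow> \<epsilon> * norm (h, A h)"
        by (intro tendsto_intros \<phi>)
      ultimately show ?thesis
        using tendsto_le[OF sequentially_bot] by blast
    qed
    note * = this
    show ?thesis
    proof (rule ccontr)
      assume "\<not> ?thesis"
      then have pos: "\<xi> \<bullet> h - \<eta> \<bullet> A h > 0" by simp
      define c where "c = \<xi> \<bullet> h - \<eta> \<bullet> A h"
      have n1: "norm (h, A h) + 1 > 0" by (simp add: add_nonneg_pos)
      \<comment> \<open>This is the bound for one particular \<open>\<epsilon>\<close>; the summand
        1 keeps the denominator positive and makes the right side strictly smaller than
        \<open>c\<close>.\<close>
      have "c \<le> c / (norm (h, A h) + 1) * norm (h, A h)"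
        using *[of "c / (norm (h, A h) + 1)"] pos n1 by (simp add: c_def)
      also have "\<dots> < c" using pos n1 by (simp add: c_def field_simps)
      finally show False by simp
    qed
  qed
  have "A (- h) = - A h" for h
    using has_derivative_bounded_linear[OF der] by (simp add: linear_simps)
  then show "\<xi> \<bullet> h = \<eta> \<bullet> A h" for h
    using le[of h] le[of "- h"] by simp
qed

text \<open>The equality part of the graph normal formula is an identity at the moving point
  \<open>xb + t k *\<^sub>R uk k\<close>. Comparing the derivative there with the one at
  \<open>xb\<close> and dividing by \<open>t k\<close> leaves a difference quotient of
  \<open>g'\<close>, whose limit supplies the Hessian term.\<close>

lemma pseudo_coderiv2_diff_sequences:
  fixes g :: "'a::euclidean_space \<Rightarrow> 'b::euclidean_space"
    and g' :: "'a \<Rightarrow> ('a \<Rightarrow>\<^sub>L 'b)" and G :: "'a \<Rightarrow>\<^sub>L ('a \<Rightarrow>\<^sub>L 'b)"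
  assumes g1: "\<And>x. (g has_derivative blinfun_apply (g' x)) (at x)"
    and g2: "(g' has_derivative blinfun_apply G) (at xb)"
    and u: "norm u = 1"
    and xs: "xs \<in> pseudo_coderiv2 {(x, y). y \<in> (\<lambda>d. g x - d) ` D} (xb, 0) (u, v) ys"
  obtains t :: "nat \<Rightarrow> real" and wk yk where
    "\<And>k. t k > 0" "t \<longlonglongrightarrow> 0" "wk \<longlonglongrightarrow> g' xb u - v" "yk \<longlonglongrightarrow> ys"
    "\<And>k. yk k \<in> reg_normal_cone D (g xb + t k *\<^sub>R wk k)"
    "adjoint (blinfun_apply (g' xb)) ys = 0"
    "(\<lambda>k. adjoint (blinfun_apply (g' xb)) (yk k /\<^sub>R t k)) \<longlonglongrightarrow> xs - adjoint (\<lambda>h. G u h) ys"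
proof -
  let ?gph = "{(x, y). y \<in> (\<lambda>d. g x - d) ` D}"
  obtain uk0 vk0 and t0 :: "nat \<Rightarrow> real" and xk0 yk0 where 0:
    "uk0 \<longlonglongrightarrow> u" "vk0 \<longlonglongrightarrow> v" "\<And>k. t0 k > 0" "t0 \<longlonglongrightarrow> 0" "xk0 \<longlonglongrightarrow> xs" "yk0 \<longlonglongrightarrow> ys"
    "\<And>k. (xk0 k, - ((1 / (t0 k * norm (uk0 k))) *\<^sub>R yk0 k)) \<in>
             reg_normal_cone ?gph (xb + t0 k *\<^sub>R uk0 k, t0 k *\<^sub>R vk0 k)"
    using xs unfolding pseudo_coderiv2_def fst_conv snd_conv add_0_left mem_Collect_eq by blast
  \<comment> \<open>Some early \<open>uk0 k\<close> may vanish, and then the convention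
    \<open>1 / 0 = 0\<close> erases \<open>yk0 k\<close> from the normal vector. Shifting the
    sequences by \<open>N\<close> excludes this.\<close>
  have "(\<lambda>k. norm (uk0 k)) \<longlonglongrightarrow> 1" using tendsto_norm[OF 0(1)] u by simp
  then have "eventually (\<lambda>k. norm (uk0 k) > 0) sequentially"
    by (rule order_tendstoD) simp
  then obtain N where N: "\<And>k. k \<ge> N \<Longrightarrow> norm (uk0 k) > 0"
    unfolding eventually_sequentially by blast
  define uk vk t xk yk where defs: "uk k = uk0 (k + N)" "vk k = vk0 (k + N)" "t k = t0 (k + N)"
    "xk k = xk0 (k + N)" "yk k = yk0 (k + N)" for k
  have lim: "uk \<longlonglongrightarrow> u" "vk \<longlonglongrightarrow> v" "t \<longlonglongrightarrow> 0" "xk \<longlonglongrightarrow> xs" "yk \<longlonglongrightarrow> ys"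
    unfolding defs using 0 by (auto intro: LIMSEQ_ignore_initial_segment)
  have t: "t k > 0" for k using 0(3) by (simp add: defs)
  have un: "norm (uk k) > 0" for k unfolding defs by (rule N) simp
  have nrm: "(xk k, - ((1 / (t k * norm (uk k))) *\<^sub>R yk k)) \<in>
             reg_normal_cone ?gph (xb + t k *\<^sub>R uk k, t k *\<^sub>R vk k)" for k
    unfolding defs by (rule 0(7))
  define c where "c k = t k * norm (uk k)" for k
  have c: "c k > 0" for k using t un by (simp add: c_def)
  \<comment> \<open>Chosen so that the base point in \<open>D\<close> equals
    \<open>g xb + t k *\<^sub>R wk k\<close> exactly, with no remainder term.\<close>
  define wk where "wk k = (g (xb + t k *\<^sub>R uk k) - g xb) /\<^sub>R t k - vk k" for k
  have wk: "wk \<longlonglongrightarrow> g' xb u - v"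
    unfolding wk_def
    by (intro tendsto_diff lim has_derivative_directional_sequence[OF g1 t])
  have pt: "g (xb + t k *\<^sub>R uk k) - t k *\<^sub>R vk k = g xb + t k *\<^sub>R wk k" for k
    using t[of k] by (simp add: wk_def algebra_simps)
  have n1: "yk k \<in> reg_normal_cone D (g xb + t k *\<^sub>R wk k)" for k
    using reg_normal_cone_scaleR[OF reg_normal_cone_graph_diff(1)[OF g1 nrm[of k]] c[of k]] t[of k] un[of k]
    by (auto simp: pt c_def split: if_splits)
  have n2: "c k * (xk k \<bullet> h) = yk k \<bullet> g' (xb + t k *\<^sub>R uk k) h" for k h
    using reg_normal_cone_graph_diff(2)[OF g1 nrm[of k], of h] t[of k] un[of k]
    by (simp add: c_def field_simps)
  let ?gT = "adjoint (blinfun_apply (g' xb))"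
  have adj: "?gT y \<bullet> h = y \<bullet> g' xb h" for y h
    by (metis adjoint_works blinfun.bounded_linear_right bounded_linear.linear inner_commute)
  have linT: "linear ?gT"
    by (simp add: adjoint_linear blinfun.bounded_linear_right bounded_linear.linear)
  \<comment> \<open>The quotients converge in the space of bounded linear maps, so they can be
    paired with the moving vectors \<open>yk k\<close> in the limit.\<close>
  define B where "B k = (g' (xb + t k *\<^sub>R uk k) - g' xb) /\<^sub>R t k" for k
  have B: "B \<longlonglongrightarrow> G u"
    unfolding B_def by (intro has_derivative_directional_sequence[OF g2 t] lim)
  have key: "?gT (yk k /\<^sub>R t k) \<bullet> h = norm (uk k) * (xk k \<bullet> h) - yk k \<bullet> B k h" for k h
  proof -
    have "yk k \<bullet> B k h = (yk k \<bullet> g' (xb + t k *\<^sub>R uk k) h - yk k \<bullet> g' xb h) / t k"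
      by (simp add: B_def blinfun.scaleR_left blinfun.diff_left inner_diff_right divide_inverse mult.commute)
    also have "\<dots> = (c k * (xk k \<bullet> h) - yk k \<bullet> g' xb h) / t k" by (simp add: n2)
    also have "\<dots> = norm (uk k) * (xk k \<bullet> h) - (yk k \<bullet> g' xb h) / t k"
      using t[of k] by (simp add: c_def field_simps)
    finally show ?thesis
      by (simp add: adj divide_inverse mult.commute)
  qed
  have limB: "(\<lambda>k. norm (uk k) * (xk k \<bullet> h) - yk k \<bullet> B k h) \<longlonglongrightarrow> (xs - adjoint (\<lambda>h. G u h) ys) \<bullet> h" for h
  proof -
    have "adjoint (\<lambda>h. G u h) ys \<bullet> h = ys \<bullet> G u h"
      by (metis adjoint_works blinfun.bounded_linear_right bounded_linear.linear inner_commute)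
    moreover have "(\<lambda>k. norm (uk k) * (xk k \<bullet> h) - yk k \<bullet> B k h) \<longlonglongrightarrow> norm u * (xs \<bullet> h) - ys \<bullet> G u h"
      by (intro tendsto_intros lim B)
    ultimately show ?thesis using u by (simp add: inner_diff_left)
  qed
  have lim2: "(\<lambda>k. ?gT (yk k /\<^sub>R t k)) \<longlonglongrightarrow> xs - adjoint (\<lambda>h. G u h) ys"
    unfolding tendsto_componentwise_iff[of "\<lambda>k. ?gT (yk k /\<^sub>R t k)"] key using limB by blast
  \<comment> \<open>The images of \<open>yk k /\<^sub>R t k\<close> converge, so multiplying by
    \<open>t k\<close> sends them to 0; continuity then puts \<open>ys\<close> into the
    kernel.\<close>
  have eq: "t k *\<^sub>R ?gT (yk k /\<^sub>R t k) = ?gT (yk k)" for k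
    using t[of k] by (simp add: linear_scale[OF linT, symmetric])
  have "(\<lambda>k. ?gT (yk k)) \<longlonglongrightarrow> 0"
    using tendsto_scaleR[OF lim(3) lim2] by (simp add: eq)
  moreover have "(\<lambda>k. ?gT (yk k)) \<longlonglongrightarrow> ?gT ys"
    using linear_conv_bounded_linear[of ?gT] linT lim(5) bounded_linear.tendsto by blast
  ultimately have "?gT ys = 0" using LIMSEQ_unique by blast
  then show thesis using that t lim wk n1 lim2 by blast
qed

subsection \<open>Tangents to the graph of the normal cone map\<close>

text \<open>Either the quotients of \<open>yk - ys\<close> by \<open>t\<close> have a bounded subsequence, whose
  limit is the graphical derivative, or they blow up, and then their normalised limit \<open>q\<close> lies
  in the kernel of \<open>L\<close> and violates both qualification conditions.\<close>
lemma graph_deriv_normal_limit: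
  fixes L :: "'b::euclidean_space \<Rightarrow> 'a::euclidean_space" and t :: "nat \<Rightarrow> real"
  assumes L: "linear L" and t: "\<And>k. t k > 0" "t \<longlonglongrightarrow> 0" and wk: "wk \<longlonglongrightarrow> w"
    and yk: "yk \<longlonglongrightarrow> ys"
    and N: "\<And>k. yk k \<in> lim_normal_cone D (yb + t k *\<^sub>R wk k)"
    and p: "(\<lambda>k. L ((yk k - ys) /\<^sub>R t k)) \<longlonglongrightarrow> p"
    and qual: "graph_deriv_normal D yb ys 0 \<inter> {z. L z = 0} = {0}
          \<or> (w \<noteq> 0 \<and> graph_subderiv_normal D yb ys (w /\<^sub>R norm w) \<inter> {z. L z = 0} = {})"
  shows "\<exists>z \<in> graph_deriv_normal D yb ys w. L z = p"
proof -
  define z where "z k = (yk k - ys) /\<^sub>R t k" for k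
  have yz: "ys + t k *\<^sub>R z k = yk k" for k
    using t(1)[of k] by (simp add: z_def)
  have blL: "bounded_linear L" using L linear_conv_bounded_linear by blast
  have subseq_case: ?thesis if r: "strict_mono r" and zl: "(z \<circ> r) \<longlonglongrightarrow> l" for r l
  proof
    have "(w, l) \<in> tan_cone (gph_normal D) (yb, ys)"
      unfolding tan_cone_def mem_Collect_eq
    proof (intro exI conjI allI)
      show "(t \<circ> r) \<longlonglongrightarrow> 0" "(\<lambda>k. ((wk \<circ> r) k, (z \<circ> r) k)) \<longlonglongrightarrow> (w, l)"
        using LIMSEQ_subseq_LIMSEQ[OF t(2) r] tendsto_Pair[OF LIMSEQ_subseq_LIMSEQ[OF wk r] zl] by auto
      show "0 < (t \<circ> r) k" for k using t by simp
      show "(yb, ys) + (t \<circ> r) k *\<^sub>R ((wk \<circ> r) k, (z \<circ> r) k) \<in> gph_normal D" for k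
        using N[of "r k"] by (simp add: gph_normal_def yz)
    qed
    then show "l \<in> graph_deriv_normal D yb ys w" by (simp add: graph_deriv_normal_def)
    have "(\<lambda>k. L ((z \<circ> r) k)) \<longlonglongrightarrow> p"
      using LIMSEQ_subseq_LIMSEQ[OF p r] by (simp add: z_def o_def)
    then show "L l = p" using bounded_linear.tendsto[OF blL zl] LIMSEQ_unique by blast
  qed
  show ?thesis
  proof (cases "filterlim (\<lambda>k. norm (z k)) at_top sequentially")
    case False
    then obtain C where "\<not> eventually (\<lambda>k. C \<le> norm (z k)) sequentially"
      unfolding filterlim_at_top by blast
    then have "frequently (\<lambda>k. norm (z k) \<le> C) sequentially"
      unfolding frequently_def by (metis (mono_tags, lifting) eventually_mono linear)
    then have "infinite {k. norm (z k) \<le> C}"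
      unfolding cofinite_eq_sequentially[symmetric] frequently_cofinite .
    from infinite_enumerate[OF this] obtain r :: "nat \<Rightarrow> nat"
      where r: "strict_mono r" "\<And>n. norm (z (r n)) \<le> C"
      by blast
    have "compact (cball (0::'b) C)" by simp
    moreover have "\<forall>n. (z \<circ> r) n \<in> cball 0 C" using r by simp
    ultimately obtain l r' where r': "strict_mono r'" "((z \<circ> r) \<circ> r') \<longlonglongrightarrow> l"
      unfolding compact_def by blast
    show ?thesis
      by (rule subseq_case[of "r \<circ> r'" l]) (use r r' in \<open>auto simp: strict_mono_o o_assoc\<close>)
  next
    case True
    then have "eventually (\<lambda>k. norm (z k) \<ge> 1) sequentially"
      unfolding filterlim_at_top by blast
    then obtain M where M: "\<And>k. k \<ge> M \<Longrightarrow> norm (z k) \<ge> 1"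
      unfolding eventually_sequentially by blast
    have sph: "\<forall>n. z (n + M) /\<^sub>R norm (z (n + M)) \<in> sphere 0 1"
    proof
      fix n show "z (n + M) /\<^sub>R norm (z (n + M)) \<in> sphere 0 1"
        using M[of "n + M"] by (auto intro: left_inverse)
    qed
    obtain q r0 where q: "q \<in> sphere 0 1" and r0: "strict_mono r0"
      and lim0: "((\<lambda>n. z (n + M) /\<^sub>R norm (z (n + M))) \<circ> r0) \<longlonglongrightarrow> q"
      by (rule seq_compactE[OF compact_imp_seq_compact[OF compact_sphere] sph])
    define r where "r n = r0 n + M" for n
    have r: "strict_mono r" using r0 by (simp add: r_def strict_mono_def)
    have zr: "norm (z (r n)) \<ge> 1" for n by (rule M) (simp add: r_def)
    have lim: "(\<lambda>n. z (r n) /\<^sub>R norm (z (r n))) \<longlonglongrightarrow> q"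
      using lim0 by (simp add: r_def o_def)
    have big: "filterlim (\<lambda>n. norm (z (r n))) at_top sequentially"
      by (rule filterlim_compose[OF True filterlim_subseq[OF r]])
    have inv: "(\<lambda>n. inverse (norm (z (r n)))) \<longlonglongrightarrow> 0"
      by (rule tendsto_inverse_0_at_top[OF big])
    \<comment> \<open>The values \<open>L (z (r n))\<close> converge while the norms of
      \<open>z (r n)\<close> blow up, so normalising annihilates the limit.\<close>
    have Lq: "L q = 0"
    proof -
      have "(\<lambda>n. inverse (norm (z (r n))) *\<^sub>R L (z (r n))) \<longlonglongrightarrow> 0 *\<^sub>R p"
        using LIMSEQ_subseq_LIMSEQ[OF p r] by (intro tendsto_scaleR inv) (simp add: z_def o_def)
      then have "(\<lambda>n. L (z (r n) /\<^sub>R norm (z (r n)))) \<longlonglongrightarrow> 0"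
        by (simp add: linear_scale[OF L])
      then show ?thesis using bounded_linear.tendsto[OF blL lim] LIMSEQ_unique by blast
    qed
    \<comment> \<open>This is the distance from \<open>yk (r n)\<close> to \<open>ys\<close>: it
      tends to 0, but more slowly than \<open>t (r n)\<close>.\<close>
    define \<tau> where "\<tau> n = t (r n) * norm (z (r n))" for n
    have \<tau>: "\<tau> n > 0" for n unfolding \<tau>_def using t(1)[of "r n"] zr[of n] by (intro mult_pos_pos) linarith+
    have \<tau>0: "\<tau> \<longlonglongrightarrow> 0"
    proof -
      have "\<tau> = (\<lambda>n. norm (yk (r n) - ys))"
      proof
        show "\<tau> n = norm (yk (r n) - ys)" for n
          using t(1)[of "r n"] by (simp add: \<tau>_def z_def)
      qed
      moreover have "(\<lambda>n. norm (yk (r n) - ys)) \<longlonglongrightarrow> norm (ys - ys)"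
        using LIMSEQ_subseq_LIMSEQ[OF yk r] by (intro tendsto_intros) (simp add: o_def)
      ultimately show ?thesis by simp
    qed
    have \<tau>t: "\<tau> n * inverse (norm (z (r n))) = t (r n)" for n
    proof -
      have "norm (z (r n)) \<noteq> 0" using zr[of n] by linarith
      then show ?thesis by (simp add: \<tau>_def)
    qed
    have ysq: "ys + \<tau> n *\<^sub>R (z (r n) /\<^sub>R norm (z (r n))) = yk (r n)" for n
      using yz[of "r n"] by (simp add: \<tau>t)
    have tr: "(\<lambda>n. t (r n)) \<longlonglongrightarrow> 0" and wr: "(\<lambda>n. wk (r n)) \<longlonglongrightarrow> w"
      using LIMSEQ_subseq_LIMSEQ[OF t(2) r] LIMSEQ_subseq_LIMSEQ[OF wk r] by (auto simp: o_def)
    have False using qual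
    proof
      assume *: "graph_deriv_normal D yb ys 0 \<inter> {z. L z = 0} = {0}"
      have "(0, q) \<in> tan_cone (gph_normal D) (yb, ys)"
        unfolding tan_cone_def mem_Collect_eq
      proof (intro exI conjI allI)
        show "\<tau> \<longlonglongrightarrow> 0" "\<And>k. 0 < \<tau> k" by (rule \<tau>0, rule \<tau>)
        \<comment> \<open>The same points of the graph are now read with step
          \<open>\<tau> n\<close> instead of \<open>t (r n)\<close>. This divides the first
          component by the norm of \<open>z (r n)\<close>, which makes its limit 0.\<close>
        have "(\<lambda>n. inverse (norm (z (r n))) *\<^sub>R wk (r n)) \<longlonglongrightarrow> 0 *\<^sub>R w"
          by (intro tendsto_scaleR inv wr)
        then show "(\<lambda>n. (inverse (norm (z (r n))) *\<^sub>R wk (r n), z (r n) /\<^sub>R norm (z (r n)))) \<longlonglongrightarrow> (0, q)"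
          by (intro tendsto_Pair lim) simp
        show "(yb, ys) + \<tau> n *\<^sub>R (inverse (norm (z (r n))) *\<^sub>R wk (r n), z (r n) /\<^sub>R norm (z (r n))) \<in> gph_normal D" for n
          using N[of "r n"] yz[of "r n"] by (simp add: gph_normal_def \<tau>t)
      qed
      then have "q \<in> graph_deriv_normal D yb ys 0 \<inter> {z. L z = 0}"
        using Lq by (simp add: graph_deriv_normal_def)
      then show False using * q by auto
    next
      assume *: "w \<noteq> 0 \<and> graph_subderiv_normal D yb ys (w /\<^sub>R norm w) \<inter> {z. L z = 0} = {}"
      then have w: "norm w > 0" by simp
      have "q \<in> graph_subderiv_normal D yb ys (w /\<^sub>R norm w)"
        unfolding graph_subderiv_normal_def mem_Collect_eq
      proof (intro conjI exI allI)
        \<comment> \<open>The subderivative takes unit directions, so the factor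
          \<open>norm w\<close> moves from the direction into the step size; the base points do not
          change.\<close>
        show "(\<lambda>n. wk (r n) /\<^sub>R norm w) \<longlonglongrightarrow> w /\<^sub>R norm w"
          by (intro tendsto_intros wr)
        show "(\<lambda>n. t (r n) * norm w) \<longlonglongrightarrow> 0"
          using tendsto_mult_right[OF tr, of "norm w"] by simp
        show "0 < t (r n) * norm w" for n using t w by simp
        have "filterlim (\<lambda>n. inverse (norm w) * norm (z (r n))) at_top sequentially"
          using w by (intro filterlim_tendsto_pos_mult_at_top[OF tendsto_const _ big]) simp
        moreover have "\<tau> n / (t (r n) * norm w) = inverse (norm w) * norm (z (r n))" for n
          using t(1)[of "r n"] w by (simp add: \<tau>_def field_simps)
        ultimately show "filterlim (\<lambda>n. \<tau> n / (t (r n) * norm w)) at_top sequentially" by simp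
        show "ys + \<tau> n *\<^sub>R (z (r n) /\<^sub>R norm (z (r n))) \<in> lim_normal_cone D (yb + (t (r n) * norm w) *\<^sub>R (wk (r n) /\<^sub>R norm w))" for n
        proof -
          have "(t (r n) * norm w) *\<^sub>R (wk (r n) /\<^sub>R norm w) = t (r n) *\<^sub>R wk (r n)" using w by simp
          then show ?thesis using N[of "r n"] by (simp only: ysq)
        qed
      qed (use q lim \<tau> \<tau>0 in auto)
      then show False using * Lq by auto
    qed
    then show ?thesis ..
  qed
qed

subsection \<open>Polyhedral cones\<close>

text \<open>Intersecting with a box around the origin loses no ray, and leaves a polytope, whose
  vertices generate the cone.\<close>
lemma polyhedral_cone_finitely_generated:
  fixes K :: "'a::euclidean_space set"
  assumes P: "polyhedron K" and C: "convex_cone K"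
  obtains F where "finite F" "K = convex_cone hull F"
proof -
  let ?B = "cbox (- One) (One :: 'a)"
  have "polytope (K \<inter> ?B)"
    unfolding polytope_eq_bounded_polyhedron using P by (simp add: bounded_Int)
  then obtain F where F: "finite F" "K \<inter> ?B = convex hull F"
    unfolding polytope_def by blast
  have "convex_cone hull F \<subseteq> K"
  proof (rule hull_minimal)
    show "F \<subseteq> K" using F hull_subset[of F convex] by blast
  qed (rule C)
  moreover have "x \<in> convex_cone hull F" if x: "x \<in> K" for x
  proof -
    \<comment> \<open>The factor brings every coordinate of \<open>x\<close> into the unit interval
      around 0 and stays positive also for \<open>x = 0\<close>, so it can be undone
      afterwards.\<close>
    define c where "c = inverse (1 + norm x)"
    have c: "c > 0" by (simp add: c_def add_pos_nonneg)
    have "\<bar>(c *\<^sub>R x) \<bullet> i\<bar> \<le> 1" if "i \<in> Basis" for i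
    proof -
      have "\<bar>x \<bullet> i\<bar> \<le> 1 + norm x" using Basis_le_norm[OF that, of x] by simp
      then show ?thesis using c
        by (simp add: c_def abs_mult field_simps add_pos_nonneg)
    qed
    then have "c *\<^sub>R x \<in> ?B"
      by (auto simp: mem_box abs_le_iff)
    moreover have "c *\<^sub>R x \<in> K" using convex_cone_scaleR[OF C _ x] c by simp
    ultimately have "c *\<^sub>R x \<in> convex_cone hull F"
      using F convex_hull_subset_convex_cone_hull by blast
    then have "inverse c *\<^sub>R (c *\<^sub>R x) \<in> convex_cone hull F"
      by (rule convex_cone_hull_mul) (use c in simp)
    then show ?thesis using c by simp
  qed
  ultimately show thesis using that F(1) by blast
qed

lemma closed_linear_image_convex_cone_hull:
  fixes L :: "'a::euclidean_space \<Rightarrow> 'b::euclidean_space"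
  assumes "linear L" "finite F"
  shows "closed (L ` (convex_cone hull F))"
  using closed_convex_cone_hull[of "L ` F"] convex_cone_hull_linear_image[OF assms(1), of F] assms(2)
  by simp

lemma polyhedron_polar_finite:
  fixes F :: "'a::euclidean_space set"
  assumes "finite F"
  shows "polyhedron {\<eta>. \<forall>v\<in>F. \<eta> \<bullet> v \<le> 0}"
proof -
  have "{\<eta>. \<forall>v\<in>F. \<eta> \<bullet> v \<le> 0} = \<Inter> ((\<lambda>v. {\<eta>. v \<bullet> \<eta> \<le> 0}) ` F)"
    by (auto simp: inner_commute)
  then show ?thesis using assms by (auto intro!: polyhedron_Inter polyhedron_halfspace_le)
qed

lemma convex_cone_polar: "convex_cone {\<eta>. \<forall>v\<in>S. \<eta> \<bullet> v \<le> 0}"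
  unfolding convex_cone_iff by (simp add: inner_add_left add_nonpos_nonpos mult_nonneg_nonpos)

lemma polar_convex_cone_hull:
  "(\<forall>v\<in>convex_cone hull F. \<eta> \<bullet> v \<le> 0) \<longleftrightarrow> (\<forall>v\<in>F. \<eta> \<bullet> v \<le> 0)"
proof
  assume "\<forall>v\<in>F. \<eta> \<bullet> v \<le> 0"
  then have "F \<subseteq> {v. \<eta> \<bullet> v \<le> 0}" by auto
  then have "convex_cone hull F \<subseteq> {v. \<eta> \<bullet> v \<le> 0}"
    by (intro hull_minimal convex_cone_halfspace_le)
  then show "\<forall>v\<in>convex_cone hull F. \<eta> \<bullet> v \<le> 0" by blast
qed (simp add: hull_inc)

text \<open>The polar of a union is the intersection of the polars, and the polar of a finitely
  generated cone is cut out by its generators alone. Only finitely many half-spaces remain.\<close>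

lemma polyhedron_polar_Union:
  fixes \<F> :: "'a::euclidean_space set set"
  assumes "finite \<F>" and "\<And>C. C \<in> \<F> \<Longrightarrow> polyhedron C \<and> convex_cone C"
  shows "polyhedron {\<eta>. \<forall>v\<in>\<Union>\<F>. \<eta> \<bullet> v \<le> 0}"
proof -
  have "polyhedron {\<eta>. \<forall>v\<in>C. \<eta> \<bullet> v \<le> 0}" if "C \<in> \<F>" for C
  proof -
    obtain F where "finite F" "C = convex_cone hull F"
      using polyhedral_cone_finitely_generated assms(2)[OF \<open>C \<in> \<F>\<close>] by blast
    then show ?thesis by (simp add: polar_convex_cone_hull polyhedron_polar_finite)
  qed
  then have "polyhedron (\<Inter> ((\<lambda>C. {\<eta>. \<forall>v\<in>C. \<eta> \<bullet> v \<le> 0}) ` \<F>))"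
    using assms(1) by (intro polyhedron_Inter) auto
  moreover have "{\<eta>. \<forall>v\<in>\<Union>\<F>. \<eta> \<bullet> v \<le> 0} = \<Inter> ((\<lambda>C. {\<eta>. \<forall>v\<in>C. \<eta> \<bullet> v \<le> 0}) ` \<F>)"
    by auto
  ultimately show ?thesis by simp
qed

subsection \<open>Local conic structure of finite unions of polyhedra\<close>

text \<open>Near a point of \<open>S\<close> only the constraints active there matter, and with zero
  right-hand sides they describe a cone. The cones are indexed by subsets of a finite family of
  constraints, so one finite collection serves all points of \<open>S\<close>.\<close>

lemma polyhedron_local_cones:
  fixes S :: "'a::euclidean_space set"
  assumes "polyhedron S"
  shows "\<exists>\<C>. finite \<C> \<and> (\<forall>C\<in>\<C>. polyhedron C \<and> convex_cone C) \<and>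
    (\<forall>x\<in>S. \<exists>C\<in>\<C>. eventually (\<lambda>h. x + h \<in> S \<longleftrightarrow> h \<in> C) (nhds 0))"
proof -
  obtain F where F: "finite F" "S = \<Inter>F" "\<And>h. h \<in> F \<Longrightarrow> \<exists>a b. a \<noteq> 0 \<and> h = {x. a \<bullet> x \<le> b}"
    using assms unfolding polyhedron_def by blast
  then obtain a b where ab: "\<And>h. h \<in> F \<Longrightarrow> h = {x. a h \<bullet> x \<le> b h}" by metis
  have S: "x \<in> S \<longleftrightarrow> (\<forall>h\<in>F. a h \<bullet> x \<le> b h)" for x
    using F(2) ab by blast
  define C where "C G = \<Inter> ((\<lambda>h. {z. a h \<bullet> z \<le> 0}) ` G)" for G
  have "polyhedron (C G) \<and> convex_cone (C G)" if "G \<subseteq> F" for G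
    unfolding C_def using finite_subset[OF that F(1)]
    by (auto intro!: polyhedron_Inter convex_cone_Inter polyhedron_halfspace_le convex_cone_halfspace_le)
  moreover have "\<exists>G\<subseteq>F. eventually (\<lambda>h. x + h \<in> S \<longleftrightarrow> h \<in> C G) (nhds 0)" if x: "x \<in> S" for x
  proof (intro exI conjI)
    let ?G = "{h \<in> F. a h \<bullet> x = b h}"
    show "?G \<subseteq> F" by auto
    have "eventually (\<lambda>z. a h \<bullet> (x + z) < b h) (nhds 0)" if "h \<in> F - ?G" for h
    proof -
      have "((\<lambda>z. a h \<bullet> (x + z)) \<longlongrightarrow> a h \<bullet> (x + 0)) (nhds 0)"
        by (intro tendsto_intros filterlim_ident)
      moreover have "a h \<bullet> (x + 0) < b h" using that x S[of x] by force
      ultimately show ?thesis by (rule order_tendstoD)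
    qed
    then have "eventually (\<lambda>z. \<forall>h\<in>F - ?G. a h \<bullet> (x + z) < b h) (nhds 0)"
      using F(1) by (intro eventually_ball_finite) auto
    then show "eventually (\<lambda>z. x + z \<in> S \<longleftrightarrow> z \<in> C ?G) (nhds 0)"
    proof eventually_elim
      case (elim z)
      have "(\<forall>h\<in>F. a h \<bullet> (x + z) \<le> b h) \<longleftrightarrow> (\<forall>h\<in>?G. a h \<bullet> (x + z) \<le> b h)"
        using elim using less_imp_le by blast
      also have "\<dots> \<longleftrightarrow> z \<in> C ?G"
        unfolding C_def by (auto simp: inner_add_right)
      finally show ?case by (simp add: S)
    qed
  qed
  ultimately show ?thesis
    using F(1) by (intro exI[of _ "C ` Pow F"] conjI ballI) (auto simp: Bex_def)
qed

text \<open>Members of \<open>Q\<close> that miss \<open>x\<close> are closed and stay away from a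
  neighbourhood of it; each of the others contributes one of its local cones. Nonemptiness of
  \<open>\<F>\<close> is recorded so that 0 lies in the union of the cones.\<close>

lemma Union_polyhedra_local_cones:
  fixes Q :: "'a::euclidean_space set set"
  assumes Q: "finite Q" "\<forall>S\<in>Q. polyhedron S"
  shows "\<exists>\<C>. finite \<C> \<and> (\<forall>C\<in>\<C>. polyhedron C \<and> convex_cone C) \<and>
    (\<forall>x\<in>\<Union>Q. \<exists>\<F>\<subseteq>\<C>. \<F> \<noteq> {} \<and> eventually (\<lambda>h. x + h \<in> \<Union>Q \<longleftrightarrow> h \<in> \<Union>\<F>) (nhds 0))"
proof -
  have "\<forall>S\<in>Q. \<exists>\<C>. finite \<C> \<and> (\<forall>C\<in>\<C>. polyhedron C \<and> convex_cone C) \<and>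
    (\<forall>x\<in>S. \<exists>C\<in>\<C>. eventually (\<lambda>h. x + h \<in> S \<longleftrightarrow> h \<in> C) (nhds 0))"
    using polyhedron_local_cones Q by blast
  from bchoice[OF this] obtain \<C> where \<C>0: "\<forall>S\<in>Q. finite (\<C> S) \<and>
      (\<forall>C\<in>\<C> S. polyhedron C \<and> convex_cone C) \<and>
      (\<forall>x\<in>S. \<exists>C\<in>\<C> S. eventually (\<lambda>h. x + h \<in> S \<longleftrightarrow> h \<in> C) (nhds 0))" ..
  have \<C>: "finite (\<C> S)"
    "\<And>C. C \<in> \<C> S \<Longrightarrow> polyhedron C \<and> convex_cone C"
    "\<And>x. x \<in> S \<Longrightarrow> \<exists>C\<in>\<C> S. eventually (\<lambda>h. x + h \<in> S \<longleftrightarrow> h \<in> C) (nhds 0)"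
    if "S \<in> Q" for S
    using bspec[OF \<C>0 that] by simp_all
  have "\<exists>\<F>\<subseteq>\<Union>(\<C> ` Q). \<F> \<noteq> {} \<and> eventually (\<lambda>h. x + h \<in> \<Union>Q \<longleftrightarrow> h \<in> \<Union>\<F>) (nhds 0)"
    if x: "x \<in> \<Union>Q" for x
  proof -
    let ?R = "{S \<in> Q. x \<in> S}"
    have "\<forall>S\<in>?R. \<exists>C. C \<in> \<C> S \<and> eventually (\<lambda>h. x + h \<in> S \<longleftrightarrow> h \<in> C) (nhds 0)"
      using \<C>(3)[of _ x] by (simp add: Bex_def)
    from bchoice[OF this] obtain c where c0:
      "\<forall>S\<in>?R. c S \<in> \<C> S \<and> eventually (\<lambda>h. x + h \<in> S \<longleftrightarrow> h \<in> c S) (nhds 0)" ..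
    have c: "c S \<in> \<C> S" "eventually (\<lambda>h. x + h \<in> S \<longleftrightarrow> h \<in> c S) (nhds 0)" if "S \<in> ?R" for S
      using bspec[OF c0 that] by simp_all
    have off: "eventually (\<lambda>h. x + h \<notin> S) (nhds 0)" if S: "S \<in> Q - ?R" for S
    proof -
      have "closed S" using Q(2) S by (intro polyhedron_imp_closed) simp
      then have "open (- S)" by (rule open_Compl)
      moreover have "((\<lambda>h. x + h) \<longlongrightarrow> x + 0) (nhds 0)" by (intro tendsto_intros filterlim_ident)
      ultimately have "eventually (\<lambda>h. x + h \<in> - S) (nhds 0)"
        using S by (intro topological_tendstoD[of _ "x + 0"]) auto
      then show ?thesis by simp
    qed
    have ev1: "eventually (\<lambda>h. \<forall>S\<in>?R. x + h \<in> S \<longleftrightarrow> h \<in> c S) (nhds 0)"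
      using Q(1) c(2) by (intro eventually_ball_finite) auto
    have ev2: "eventually (\<lambda>h. \<forall>S\<in>Q - ?R. x + h \<notin> S) (nhds 0)"
      using Q(1) off by (intro eventually_ball_finite) auto
    have "eventually (\<lambda>h. x + h \<in> \<Union>Q \<longleftrightarrow> h \<in> \<Union>(c ` ?R)) (nhds 0)"
      using ev1 ev2
    proof eventually_elim
      case (elim h)
      have "x + h \<in> \<Union>Q \<longleftrightarrow> (\<exists>S\<in>?R. x + h \<in> S)" using elim(2) by blast
      also have "\<dots> \<longleftrightarrow> (\<exists>S\<in>?R. h \<in> c S)" using elim(1) by blast
      finally show ?case by blast
    qed
    moreover have "c ` ?R \<subseteq> \<Union>(\<C> ` Q)" "c ` ?R \<noteq> {}" using c(1) x by auto
    ultimately show ?thesis by blast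
  qed
  then have "\<forall>x\<in>\<Union>Q. \<exists>\<F>\<subseteq>\<Union>(\<C> ` Q). \<F> \<noteq> {} \<and>
      eventually (\<lambda>h. x + h \<in> \<Union>Q \<longleftrightarrow> h \<in> \<Union>\<F>) (nhds 0)" by (rule ballI)
  moreover have "finite (\<Union>(\<C> ` Q))" using \<C>(1) Q(1) by simp
  moreover have "\<forall>C\<in>\<Union>(\<C> ` Q). polyhedron C \<and> convex_cone C" using \<C>(2) by simp
  ultimately show ?thesis by (rule_tac x = "\<Union>(\<C> ` Q)" in exI) (rule conjI; (rule conjI)?; assumption)
qed

section \<open>Normals and tangents of sets that are locally cones\<close>

text \<open>A direction in \<open>T\<close> can be scaled down into the neighbourhood where
  \<open>T\<close> describes \<open>Q\<close>; dividing the normal inequality by the scale and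
  letting \<open>\<epsilon>\<close> tend to 0 gives the polar inequality. The converse holds with
  right-hand side 0. Here \<open>T\<close> may be a nonconvex union of cones.\<close>

lemma reg_normal_cone_local_cone:
  fixes T :: "'a::euclidean_space set"
  assumes T: "conic T" "0 \<in> T"
    and loc: "eventually (\<lambda>h. x + h \<in> Q \<longleftrightarrow> h \<in> T) (nhds 0)"
  shows "reg_normal_cone Q x = {\<eta>. \<forall>v\<in>T. \<eta> \<bullet> v \<le> 0}"
proof -
  obtain r where r: "r > 0" "\<And>h. norm h < r \<Longrightarrow> x + h \<in> Q \<longleftrightarrow> h \<in> T"
    using loc unfolding eventually_nhds_metric by (auto simp: dist_norm)
  have xQ: "x \<in> Q" using r(2)[of 0] r(1) T by simp
  show ?thesis
  proof (intro set_eqI iffI)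
    fix \<eta> assume \<eta>: "\<eta> \<in> reg_normal_cone Q x"
    have "\<eta> \<bullet> v \<le> 0" if v: "v \<in> T" for v
    proof (cases "v = 0")
      case False
      then have nv: "norm v > 0" by simp
      have "\<eta> \<bullet> v \<le> \<epsilon> * norm v" if e: "\<epsilon> > 0" for \<epsilon>
      proof -
        obtain \<delta> where d: "\<delta> > 0" "\<And>x'. x' \<in> Q \<Longrightarrow> dist x' x < \<delta> \<Longrightarrow> \<eta> \<bullet> (x' - x) \<le> \<epsilon> * norm (x' - x)"
          using \<eta> e unfolding reg_normal_cone_def by blast
        \<comment> \<open>The factor 2 places the scaled vector strictly inside both radii.\<close>
        define s where "s = min r \<delta> / (2 * norm v)"
        have s: "s > 0" using r d nv by (simp add: s_def)
        have "norm (s *\<^sub>R v) = min r \<delta> / 2"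
          using r d nv by (simp add: s_def)
        then have ns: "norm (s *\<^sub>R v) < r" "norm (s *\<^sub>R v) < \<delta>" using r d by linarith+
        have "x + s *\<^sub>R v \<in> Q" using r(2)[OF ns(1)] conicD[OF T(1) v, of s] s by simp
        then have "\<eta> \<bullet> (s *\<^sub>R v) \<le> \<epsilon> * norm (s *\<^sub>R v)"
          using d(2)[of "x + s *\<^sub>R v"] ns(2) by (simp add: dist_norm)
        then have "s * (\<eta> \<bullet> v) \<le> s * (\<epsilon> * norm v)" using s by (simp add: algebra_simps)
        then show ?thesis using s by simp
      qed
      note * = this
      show ?thesis
      proof (rule field_le_epsilon)
        fix e :: real assume "e > 0"
        then show "\<eta> \<bullet> v \<le> 0 + e" using *[of "e / norm v"] nv by simp
      qed
    qed simp
    then show "\<eta> \<in> {\<eta>. \<forall>v\<in>T. \<eta> \<bullet> v \<le> 0}" by simp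
  next
    fix \<eta> assume "\<eta> \<in> {\<eta>. \<forall>v\<in>T. \<eta> \<bullet> v \<le> 0}"
    then have \<eta>: "\<And>v. v \<in> T \<Longrightarrow> \<eta> \<bullet> v \<le> 0" by blast
    have "\<eta> \<bullet> (x' - x) \<le> \<epsilon> * norm (x' - x)" if "\<epsilon> > 0" "x' \<in> Q" "dist x' x < r" for \<epsilon> x'
    proof -
      have "x' - x \<in> T" using r(2)[of "x' - x"] that by (simp add: dist_norm)
      then have "\<eta> \<bullet> (x' - x) \<le> 0" by (rule \<eta>)
      also have "0 \<le> \<epsilon> * norm (x' - x)" using that by simp
      finally show ?thesis .
    qed
    then show "\<eta> \<in> reg_normal_cone Q x"
      unfolding reg_normal_cone_def using xQ r(1) by blast
  qed
qed

text \<open>Conicity allows division of \<open>t k *\<^sub>R wk k\<close> by \<open>t k\<close>, so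
  \<open>wk k\<close> eventually lies in \<open>T\<close>, and closedness passes this to the limit.
  Conversely, a vector of \<open>T\<close> is tangent with constant directions once the initial
  steps are dropped.\<close>

lemma tan_cone_local_cone:
  fixes T :: "'a::euclidean_space set"
  assumes T: "conic T" "closed T"
    and loc: "eventually (\<lambda>h. x + h \<in> Q \<longleftrightarrow> h \<in> T) (nhds 0)"
  shows "tan_cone Q x = T"
proof (intro set_eqI iffI)
  fix w assume "w \<in> tan_cone Q x"
  then obtain t :: "nat \<Rightarrow> real" and wk where
    t: "\<And>k. t k > 0" "t \<longlonglongrightarrow> 0" "wk \<longlonglongrightarrow> w" "\<And>k. x + t k *\<^sub>R wk k \<in> Q"
    unfolding tan_cone_def by blast
  have "(\<lambda>k. t k *\<^sub>R wk k) \<longlonglongrightarrow> 0" using tendsto_scaleR[OF t(2,3)] by simp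
  then have "eventually (\<lambda>k. x + t k *\<^sub>R wk k \<in> Q \<longleftrightarrow> t k *\<^sub>R wk k \<in> T) sequentially"
    using loc by (rule eventually_compose_filterlim[rotated])
  then have "eventually (\<lambda>k. wk k \<in> T) sequentially"
  proof eventually_elim
    case (elim k)
    then have "t k *\<^sub>R wk k \<in> T" using t(4)[of k] by simp
    from conicD[OF T(1) this, of "inverse (t k)"] show ?case using t(1)[of k] by simp
  qed
  then show "w \<in> T" using Lim_in_closed_set[OF T(2) _ _ t(3)] by simp
next
  fix w assume w: "w \<in> T"
  have s0: "(\<lambda>n. inverse (real (Suc n)) *\<^sub>R w) \<longlonglongrightarrow> 0"
    using tendsto_scaleR[OF LIMSEQ_inverse_real_of_nat tendsto_const, of w] by simp
  then have "eventually (\<lambda>n. x + inverse (real (Suc n)) *\<^sub>R w \<in> Q \<longleftrightarrow> inverse (real (Suc n)) *\<^sub>R w \<in> T) sequentially"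
    using loc by (rule eventually_compose_filterlim[rotated])
  then obtain N where N: "\<And>n. n \<ge> N \<Longrightarrow> x + inverse (real (Suc n)) *\<^sub>R w \<in> Q \<longleftrightarrow> inverse (real (Suc n)) *\<^sub>R w \<in> T"
    unfolding eventually_sequentially by blast
  have "x + inverse (real (Suc (n + N))) *\<^sub>R w \<in> Q" for n
    using N[of "n + N"] conicD[OF T(1) w, of "inverse (real (Suc (n + N)))"] by simp
  moreover have "(\<lambda>n. inverse (real (Suc (n + N)))) \<longlonglongrightarrow> 0"
    by (rule LIMSEQ_ignore_initial_segment[OF LIMSEQ_inverse_real_of_nat])
  ultimately show "w \<in> tan_cone Q x"
    unfolding tan_cone_def mem_Collect_eq
    by (intro exI[of _ "\<lambda>n. inverse (real (Suc (n + N)))"] exI[of _ "\<lambda>_. w"]) auto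
qed

text \<open>Each normal cone is the polar of a subfamily of one finite family of cones, so only
  finitely many can occur. This is what later allows a subsequence of normals to stay in a single
  cone.\<close>

lemma finite_reg_normal_cones_Union_polyhedra:
  fixes Q :: "'a::euclidean_space set set"
  assumes Q: "finite Q" "\<forall>S\<in>Q. polyhedron S"
  shows "finite (reg_normal_cone (\<Union>Q) ` \<Union>Q)"
    "\<And>x. x \<in> \<Union>Q \<Longrightarrow> polyhedron (reg_normal_cone (\<Union>Q) x) \<and> convex_cone (reg_normal_cone (\<Union>Q) x)"
proof -
  obtain \<C> where \<C>: "finite \<C>" "\<forall>C\<in>\<C>. polyhedron C \<and> convex_cone C"
    and loc: "\<forall>x\<in>\<Union>Q. \<exists>\<F>\<subseteq>\<C>. \<F> \<noteq> {} \<and> eventually (\<lambda>h. x + h \<in> \<Union>Q \<longleftrightarrow> h \<in> \<Union>\<F>) (nhds 0)"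
    using Union_polyhedra_local_cones[OF Q] by (elim exE conjE) (rule that)
  let ?polar = "\<lambda>\<F>. {\<eta>. \<forall>v\<in>\<Union>\<F>. \<eta> \<bullet> v \<le> 0}"
  have eq: "\<exists>\<F>\<subseteq>\<C>. reg_normal_cone (\<Union>Q) x = ?polar \<F>" if x: "x \<in> \<Union>Q" for x
  proof -
    obtain \<F> where \<F>: "\<F> \<subseteq> \<C>" "\<F> \<noteq> {}" "eventually (\<lambda>h. x + h \<in> \<Union>Q \<longleftrightarrow> h \<in> \<Union>\<F>) (nhds 0)"
      using bspec[OF loc x] by (elim exE conjE) (rule that)
    have cc: "convex_cone C" if "C \<in> \<F>" for C using \<C>(2) \<F>(1) that by blast
    have "conic (\<Union>\<F>)" using cc unfolding conic_def by (meson Union_iff convex_cone_scaleR)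
    moreover have "0 \<in> \<Union>\<F>" using cc \<F>(2) convex_cone_contains_0 by blast
    ultimately have "reg_normal_cone (\<Union>Q) x = ?polar \<F>"
      using \<F>(3) by (rule reg_normal_cone_local_cone)
    then show ?thesis using \<F>(1) by blast
  qed
  have "reg_normal_cone (\<Union>Q) x \<in> ?polar ` Pow \<C>" if x: "x \<in> \<Union>Q" for x
  proof -
    obtain \<F> where \<F>: "\<F> \<subseteq> \<C>" "reg_normal_cone (\<Union>Q) x = ?polar \<F>"
      using eq[OF x] by (elim exE conjE) (rule that)
    show ?thesis unfolding \<F>(2) by (rule imageI) (use \<F>(1) in simp)
  qed
  then have "reg_normal_cone (\<Union>Q) ` \<Union>Q \<subseteq> ?polar ` Pow \<C>" by (rule image_subsetI)
  then show "finite (reg_normal_cone (\<Union>Q) ` \<Union>Q)"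
    by (rule finite_subset) (use \<C>(1) in simp)
  show "polyhedron (reg_normal_cone (\<Union>Q) x) \<and> convex_cone (reg_normal_cone (\<Union>Q) x)"
    if x: "x \<in> \<Union>Q" for x
  proof -
    obtain \<F> where \<F>: "\<F> \<subseteq> \<C>" "reg_normal_cone (\<Union>Q) x = ?polar \<F>"
      using eq[OF x] by (elim exE conjE) (rule that)
    have "polyhedron (?polar \<F>)"
      using \<F>(1) \<C> by (intro polyhedron_polar_Union) (auto intro: finite_subset)
    then show ?thesis unfolding \<F>(2) using convex_cone_polar by (rule conjI)
  qed
qed

text \<open>Since \<open>y\<close> is interior to the box, intersecting with the box changes nothing
  near \<open>y\<close>. There \<open>D\<close> is a translate of a finite union of polyhedral
  cones, and this closed conic union must be the tangent cone.\<close>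

lemma locally_polyhedral_tan_cone:
  fixes D :: "'a::euclidean_space set"
  assumes "locally_polyhedral D y"
  obtains Q where "finite Q" "\<forall>S\<in>Q. polyhedron S" "tan_cone D y = \<Union>Q"
    "conic (tan_cone D y)" "eventually (\<lambda>h. y + h \<in> D \<longleftrightarrow> h \<in> tan_cone D y) (nhds 0)"
proof -
  obtain a b P where yD: "y \<in> D" and y: "y \<in> box a b" and P: "finite P" "\<forall>S\<in>P. polyhedron S"
    "D \<inter> cbox a b = \<Union>P"
    using assms unfolding locally_polyhedral_def by (elim conjE exE) (rule that; simp)
  obtain \<C> where \<C>: "finite \<C>" "\<forall>C\<in>\<C>. polyhedron C \<and> convex_cone C"
    and loc: "\<forall>x\<in>\<Union>P. \<exists>\<F>\<subseteq>\<C>. \<F> \<noteq> {} \<and> eventually (\<lambda>h. x + h \<in> \<Union>P \<longleftrightarrow> h \<in> \<Union>\<F>) (nhds 0)"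
    using Union_polyhedra_local_cones[OF P(1,2)] by (elim exE conjE) (rule that)
  have yP: "y \<in> \<Union>P" using yD y box_subset_cbox P(3) by blast
  obtain \<F> where \<F>: "\<F> \<subseteq> \<C>" "eventually (\<lambda>h. y + h \<in> \<Union>P \<longleftrightarrow> h \<in> \<Union>\<F>) (nhds 0)"
    using bspec[OF loc yP] by (elim exE conjE) (rule that)
  have poly: "polyhedron C" "convex_cone C" if "C \<in> \<F>" for C using \<C>(2) \<F>(1) that by blast+
  have fin: "finite \<F>" using \<C>(1) \<F>(1) finite_subset by blast
  have con: "conic (\<Union>\<F>)" using poly unfolding conic_def by (meson Union_iff convex_cone_scaleR)
  have clo: "closed (\<Union>\<F>)" using poly fin polyhedron_imp_closed by (intro closed_Union) auto
  have "((\<lambda>h. y + h) \<longlongrightarrow> y + 0) (nhds 0)" by (intro tendsto_intros filterlim_ident)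
  then have "eventually (\<lambda>h. y + h \<in> box a b) (nhds 0)"
    by (rule topological_tendstoD) (use y in \<open>auto simp: open_box\<close>)
  with \<F>(2) have ev: "eventually (\<lambda>h. y + h \<in> D \<longleftrightarrow> h \<in> \<Union>\<F>) (nhds 0)"
  proof eventually_elim
    case (elim h)
    then show ?case using P(3) box_subset_cbox by blast
  qed
  have "tan_cone D y = \<Union>\<F>" by (rule tan_cone_local_cone[OF con clo ev])
  then show thesis using that[of \<F>] fin poly con ev by simp
qed

section \<open>Dilation and directional normal cones\<close>

text \<open>Both sides of the normal inequality are multiplied by \<open>c\<close> under the
  dilation, so the same \<open>\<eta>\<close> remains normal; only the radius changes, to
  \<open>\<delta> / c\<close>.\<close>

lemma reg_normal_cone_rescale_subset:
  fixes x :: "'a::euclidean_space"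
  assumes c: "c > 0" and ev: "eventually (\<lambda>h. x + c *\<^sub>R h \<in> Q \<longleftrightarrow> z + h \<in> R) (nhds 0)"
  shows "reg_normal_cone Q x \<subseteq> reg_normal_cone R z"
proof
  fix \<eta> assume \<eta>: "\<eta> \<in> reg_normal_cone Q x"
  obtain r where r: "r > 0" "\<And>h. norm h < r \<Longrightarrow> x + c *\<^sub>R h \<in> Q \<longleftrightarrow> z + h \<in> R"
    using ev unfolding eventually_nhds_metric by (auto simp: dist_norm)
  have "x \<in> Q" using \<eta> by (simp add: reg_normal_cone_def)
  then have "z \<in> R" using r(2)[of 0] r(1) by simp
  moreover have "\<exists>\<delta>>0. \<forall>x'\<in>R. dist x' z < \<delta> \<longrightarrow> \<eta> \<bullet> (x' - z) \<le> \<epsilon> * norm (x' - z)"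
    if e: "\<epsilon> > 0" for \<epsilon>
  proof -
    obtain \<delta> where d: "\<delta> > 0" "\<And>x'. x' \<in> Q \<Longrightarrow> dist x' x < \<delta> \<Longrightarrow> \<eta> \<bullet> (x' - x) \<le> \<epsilon> * norm (x' - x)"
      using \<eta> e unfolding reg_normal_cone_def by blast
    show ?thesis
    proof (intro exI conjI ballI impI)
      show "min r (\<delta> / c) > 0" using r d c by simp
      fix z' assume z': "z' \<in> R" "dist z' z < min r (\<delta> / c)"
      then have "x + c *\<^sub>R (z' - z) \<in> Q" using r(2)[of "z' - z"] by (simp add: dist_norm)
      moreover have "norm (c *\<^sub>R (z' - z)) < \<delta>"
        using z'(2) c by (simp add: dist_norm pos_less_divide_eq mult.commute)
      ultimately have "\<eta> \<bullet> (c *\<^sub>R (z' - z)) \<le> \<epsilon> * norm (c *\<^sub>R (z' - z))"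
        using d(2)[of "x + c *\<^sub>R (z' - z)"] by (simp add: dist_norm)
      then have "c * (\<eta> \<bullet> (z' - z)) \<le> c * (\<epsilon> * norm (z' - z))"
        using c unfolding norm_scaleR inner_scaleR_right by (simp add: mult.left_commute)
      then show "\<eta> \<bullet> (z' - z) \<le> \<epsilon> * norm (z' - z)" using c by simp
    qed
  qed
  ultimately show "\<eta> \<in> reg_normal_cone R z" unfolding reg_normal_cone_def by blast
qed

lemma reg_normal_cone_rescale:
  fixes x :: "'a::euclidean_space"
  assumes c: "c > 0" and ev: "eventually (\<lambda>h. x + c *\<^sub>R h \<in> Q \<longleftrightarrow> z + h \<in> R) (nhds 0)"
  shows "reg_normal_cone Q x = reg_normal_cone R z"
proof
  show "reg_normal_cone Q x \<subseteq> reg_normal_cone R z"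
    by (rule reg_normal_cone_rescale_subset[OF c ev])
  have "((\<lambda>h. inverse c *\<^sub>R h) \<longlongrightarrow> inverse c *\<^sub>R 0) (nhds (0::'a))"
    by (intro tendsto_intros filterlim_ident)
  then have "eventually (\<lambda>h. x + c *\<^sub>R (inverse c *\<^sub>R h) \<in> Q \<longleftrightarrow> z + inverse c *\<^sub>R h \<in> R) (nhds 0)"
    using ev by (intro eventually_compose_filterlim[OF ev]) simp
  then have "eventually (\<lambda>h. z + inverse c *\<^sub>R h \<in> R \<longleftrightarrow> x + h \<in> Q) (nhds 0)"
    by eventually_elim (use c in simp)
  then show "reg_normal_cone R z \<subseteq> reg_normal_cone Q x"
    by (rule reg_normal_cone_rescale_subset[rotated]) (use c in simp)
qed

text \<open>Dilating by \<open>inverse t\<close> carries \<open>D\<close> near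
  \<open>y + t *\<^sub>R w\<close> to \<open>T\<close> near \<open>w\<close>, because
  \<open>T\<close> is conic. The radius \<open>r\<close> is uniform in \<open>t\<close> and
  \<open>w\<close>, as needed along sequences.\<close>

lemma reg_normal_cone_eq_local_cone:
  fixes T :: "'a::euclidean_space set"
  assumes T: "conic T" and loc: "eventually (\<lambda>h. y + h \<in> D \<longleftrightarrow> h \<in> T) (nhds 0)"
  obtains r where "r > 0"
    "\<And>t w. t > 0 \<Longrightarrow> norm (t *\<^sub>R w) < r \<Longrightarrow> reg_normal_cone D (y + t *\<^sub>R w) = reg_normal_cone T w"
proof -
  obtain r where r: "r > 0" "\<And>h. norm h < r \<Longrightarrow> y + h \<in> D \<longleftrightarrow> h \<in> T"
    using loc unfolding eventually_nhds_metric by (auto simp: dist_norm)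
  have "reg_normal_cone D (y + t *\<^sub>R w) = reg_normal_cone T w" if t: "t > 0" and w: "norm (t *\<^sub>R w) < r" for t w
  proof (rule reg_normal_cone_rescale[OF t])
    have "((\<lambda>h. norm (t *\<^sub>R (w + h))) \<longlongrightarrow> norm (t *\<^sub>R (w + 0))) (nhds 0)"
      by (intro tendsto_intros filterlim_ident)
    then have "eventually (\<lambda>h. norm (t *\<^sub>R (w + h)) < r) (nhds 0)"
      by (rule order_tendstoD) (use w in simp)
    then show "eventually (\<lambda>h. y + t *\<^sub>R w + t *\<^sub>R h \<in> D \<longleftrightarrow> w + h \<in> T) (nhds 0)"
    proof eventually_elim
      case (elim h)
      have "y + t *\<^sub>R w + t *\<^sub>R h \<in> D \<longleftrightarrow> t *\<^sub>R (w + h) \<in> T"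
        using r(2)[OF elim] by (simp add: algebra_simps)
      also have "\<dots> \<longleftrightarrow> w + h \<in> T"
        using conicD[OF T, of "w + h" t] conicD[OF T, of "t *\<^sub>R (w + h)" "inverse t"] t by auto
      finally show ?case .
    qed
  qed
  then show thesis using that r(1) by blast
qed

text \<open>For small \<open>t *\<^sub>R w\<close> the normals to \<open>D\<close> at
  \<open>y + t *\<^sub>R w\<close> are those to \<open>T\<close> at \<open>w\<close>, so the
  sequences in the two definitions can be converted into each other.\<close>

lemma dir_normal_cone_local_cone:
  fixes T :: "'a::euclidean_space set"
  assumes T: "conic T" and loc: "eventually (\<lambda>h. y + h \<in> D \<longleftrightarrow> h \<in> T) (nhds 0)"
  shows "dir_normal_cone D y w = lim_normal_cone T w"
proof -
  obtain r where r: "r > 0"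
    "\<And>t w. t > 0 \<Longrightarrow> norm (t *\<^sub>R w) < r \<Longrightarrow> reg_normal_cone D (y + t *\<^sub>R w) = reg_normal_cone T w"
    using reg_normal_cone_eq_local_cone[OF T loc] by blast
  show ?thesis
  proof (intro set_eqI iffI)
    fix \<eta> assume "\<eta> \<in> dir_normal_cone D y w"
    then obtain t :: "nat \<Rightarrow> real" and wk \<eta>k where
      t: "\<And>k. t k > 0" "t \<longlonglongrightarrow> 0" "wk \<longlonglongrightarrow> w" "\<eta>k \<longlonglongrightarrow> \<eta>"
        "\<And>k. \<eta>k k \<in> reg_normal_cone D (y + t k *\<^sub>R wk k)"
      unfolding dir_normal_cone_def by blast
    have "(\<lambda>k. norm (t k *\<^sub>R wk k)) \<longlonglongrightarrow> norm (0 *\<^sub>R w)" by (intro tendsto_intros t)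
    then have "eventually (\<lambda>k. norm (t k *\<^sub>R wk k) < r) sequentially"
      by (rule order_tendstoD) (use r in simp)
    then obtain N where N: "\<And>k. k \<ge> N \<Longrightarrow> norm (t k *\<^sub>R wk k) < r"
      unfolding eventually_sequentially by blast
    have m: "\<eta>k (k + N) \<in> reg_normal_cone T (wk (k + N))" for k
      using r(2)[OF t(1) N, of "k + N"] t(5)[of "k + N"] by simp
    moreover from m have "wk (k + N) \<in> T" for k by (simp add: reg_normal_cone_def)
    moreover note LIMSEQ_ignore_initial_segment[OF t(3), of N] LIMSEQ_ignore_initial_segment[OF t(4), of N]
    ultimately show "\<eta> \<in> lim_normal_cone T w"
      unfolding lim_normal_cone_def by blast
  next
    fix \<eta> assume "\<eta> \<in> lim_normal_cone T w"
    then obtain xk \<eta>k where x: "xk \<longlonglongrightarrow> w" "\<eta>k \<longlonglongrightarrow> \<eta>" "\<And>k. \<eta>k k \<in> reg_normal_cone T (xk k)"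
      unfolding lim_normal_cone_def by blast
    \<comment> \<open>The denominator makes \<open>t k *\<^sub>R xk k\<close> shorter than
      \<open>r\<close> for every \<open>k\<close>, not only eventually, and never vanishes.\<close>
    define t where "t k = r * inverse (real (Suc k)) / (1 + norm (xk k))" for k
    have t: "t k > 0" for k using r(1) by (simp add: t_def add_pos_nonneg)
    have "1 + norm w \<noteq> 0" by (metis add_pos_nonneg less_irrefl norm_ge_zero zero_less_one)
    then have "t \<longlonglongrightarrow> r * 0 / (1 + norm w)"
      unfolding t_def by (intro tendsto_intros x LIMSEQ_inverse_real_of_nat)
    then have t0: "t \<longlonglongrightarrow> 0" by simp
    have "norm (t k *\<^sub>R xk k) < r" for k
    proof -
      have "norm (t k *\<^sub>R xk k) = r * inverse (real (Suc k)) * (norm (xk k) / (1 + norm (xk k)))"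
        using t[of k] unfolding norm_scaleR abs_of_pos[OF t] by (simp add: t_def)
      also have "\<dots> \<le> r * 1 * (norm (xk k) / (1 + norm (xk k)))"
        using r(1) by (intro mult_right_mono mult_left_mono) (auto simp: field_simps)
      also have "\<dots> < r" using r(1) by (simp add: field_simps add_pos_nonneg)
      finally show ?thesis .
    qed
    then have "\<eta>k k \<in> reg_normal_cone D (y + t k *\<^sub>R xk k)" for k
      using r(2)[OF t] x(3) by simp
    then show "\<eta> \<in> dir_normal_cone D y w"
      unfolding dir_normal_cone_def using t t0 x by blast
  qed
qed

section \<open>Multipliers in the polyhedral case\<close>

lemma tan_cone_mono: "A \<subseteq> B \<Longrightarrow> tan_cone A x \<subseteq> tan_cone B x"
proof
  fix w assume AB: "A \<subseteq> B" and "w \<in> tan_cone A x"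
  then obtain t :: "nat \<Rightarrow> real" and wk where "\<forall>k. t k > 0" "t \<longlonglongrightarrow> 0" "wk \<longlonglongrightarrow> w"
    and A: "\<forall>k. x + t k *\<^sub>R wk k \<in> A"
    unfolding tan_cone_def by blast
  moreover have "\<forall>k. x + t k *\<^sub>R wk k \<in> B" using A AB by blast
  ultimately show "w \<in> tan_cone B x" unfolding tan_cone_def by blast
qed

text \<open>Elements of the hull have the form \<open>k - c *\<^sub>R y\<close>. If
  \<open>t * c \<le> 1\<close>, a step of length \<open>t\<close> leads from \<open>y\<close> to
  \<open>(1 - t * c) *\<^sub>R y + t *\<^sub>R k\<close>, a conic combination inside
  \<open>K\<close>.\<close>

lemma convex_cone_hull_insert_minus_subset_tan_cone:
  fixes K :: "'a::euclidean_space set"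
  assumes K: "convex_cone K" and y: "y \<in> K"
  shows "convex_cone hull (insert (- y) K) \<subseteq> tan_cone K y"
proof -
  let ?R = "{k - c *\<^sub>R y | k c. k \<in> K \<and> c \<ge> (0::real)}"
  have "convex_cone hull (insert (- y) K) \<subseteq> ?R"
  proof (rule hull_minimal)
    have "- y = 0 - 1 *\<^sub>R y" by simp
    then have "- y \<in> ?R" using convex_cone_contains_0[OF K] zero_le_one by blast
    moreover have "k \<in> ?R" if "k \<in> K" for k
    proof -
      have "k = k - 0 *\<^sub>R y" by simp
      then show ?thesis using that by blast
    qed
    ultimately show "insert (- y) K \<subseteq> ?R" by blast
    show "convex_cone ?R"
      unfolding convex_cone_iff
    proof (intro conjI ballI allI impI)
      show "0 \<in> ?R" using convex_cone_contains_0[OF K] by force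
      fix a b assume "a \<in> ?R" "b \<in> ?R"
      then obtain k c k' c' where "a = k - c *\<^sub>R y" "k \<in> K" "c \<ge> 0" "b = k' - c' *\<^sub>R y" "k' \<in> K" "c' \<ge> 0"
        by blast
      then have "a + b = (k + k') - (c + c') *\<^sub>R y" "k + k' \<in> K" "c + c' \<ge> 0"
        using convex_cone_add[OF K] by (auto simp: algebra_simps)
      then show "a + b \<in> ?R" by blast
    next
      fix a and s :: real assume "a \<in> ?R" "s \<ge> 0"
      then obtain k c where "a = k - c *\<^sub>R y" "k \<in> K" "c \<ge> 0" by blast
      then have "s *\<^sub>R a = s *\<^sub>R k - (s * c) *\<^sub>R y" "s *\<^sub>R k \<in> K" "s * c \<ge> 0"
        using convex_cone_scaleR[OF K] \<open>s \<ge> 0\<close> by (auto simp: algebra_simps)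
      then show "s *\<^sub>R a \<in> ?R" by blast
    qed
  qed
  also have "?R \<subseteq> tan_cone K y"
  proof
    fix w assume "w \<in> ?R"
    then obtain k c where w: "w = k - c *\<^sub>R y" "k \<in> K" "c \<ge> 0" by blast
    define t where "t n = inverse (real (Suc n)) / (1 + c)" for n
    have t: "t n > 0" for n using w(3) by (simp add: t_def)
    have t0: "t \<longlonglongrightarrow> 0"
      unfolding t_def using tendsto_divide_zero[OF LIMSEQ_inverse_real_of_nat] by blast
    have "y + t n *\<^sub>R w \<in> K" for n
    proof -
      have "t n * c = inverse (real (Suc n)) * (c / (1 + c))" by (simp add: t_def)
      also have "\<dots> \<le> 1 * 1" using w(3) by (intro mult_mono) (auto simp: field_simps)
      finally have "1 - t n * c \<ge> 0" by simp
      then have "(1 - t n * c) *\<^sub>R y + t n *\<^sub>R k \<in> K"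
        using t[of n] y w(2) by (intro convex_cone_add[OF K] convex_cone_scaleR[OF K]) auto
      then show ?thesis by (simp add: w(1) algebra_simps)
    qed
    then show "w \<in> tan_cone K y"
      unfolding tan_cone_def mem_Collect_eq
      by (intro exI[of _ t] exI[of _ "\<lambda>_. w"]) (use t t0 in auto)
  qed
  finally show ?thesis .
qed

text \<open>Along a subsequence \<open>yk\<close> stays in one fixed polyhedral cone \<open>K\<close>. Both \<open>K\<close> and the cone
  generated by \<open>K - ys\<close> are finitely generated, so their linear images are closed and
  contain the limit \<open>p\<close>, even though the preimages need not be bounded.\<close>
lemma polyhedral_multipliers:
  fixes L :: "'b::euclidean_space \<Rightarrow> 'a::euclidean_space" and t :: "nat \<Rightarrow> real"
  assumes Q: "finite Q" "\<forall>S\<in>Q. polyhedron S"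
    and L: "linear L" and t: "\<And>k. t k > 0" and wk: "wk \<longlonglongrightarrow> w" and yk: "yk \<longlonglongrightarrow> ys"
    and N: "\<And>k. yk k \<in> reg_normal_cone (\<Union>Q) (wk k)"
    and Lys: "L ys = 0" and p: "(\<lambda>k. L (yk k /\<^sub>R t k)) \<longlonglongrightarrow> p"
  shows "\<exists>z1 \<in> lim_normal_cone (\<Union>Q) w. L z1 = p"
    and "\<exists>z2 \<in> tan_cone (lim_normal_cone (\<Union>Q) w) ys. L z2 = p"
proof -
  let ?T = "\<Union>Q"
  have wT: "wk k \<in> ?T" for k using N[of k] by (simp add: reg_normal_cone_def)
  have "finite (range (\<lambda>k. reg_normal_cone ?T (wk k)))"
    by (rule finite_subset[OF _ finite_reg_normal_cones_Union_polyhedra(1)[OF Q]]) (use wT in auto)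
  then obtain k0 where "infinite {k. reg_normal_cone ?T (wk k) = reg_normal_cone ?T (wk k0)}"
    using pigeonhole_infinite[of UNIV "\<lambda>k. reg_normal_cone ?T (wk k)"] by auto
  from infinite_enumerate[OF this] obtain r :: "nat \<Rightarrow> nat"
    where "strict_mono r \<and> (\<forall>n. r n \<in> {k. reg_normal_cone ?T (wk k) = reg_normal_cone ?T (wk k0)})" ..
  then have r: "strict_mono r" "\<And>n. reg_normal_cone ?T (wk (r n)) = reg_normal_cone ?T (wk k0)"
    by simp_all
  define K where "K = reg_normal_cone ?T (wk k0)"
  have K: "polyhedron K" "convex_cone K"
    using finite_reg_normal_cones_Union_polyhedra(2)[OF Q wT[of k0]] by (auto simp: K_def)
  have yK: "yk (r n) \<in> K" for n using N[of "r n"] r(2) by (simp add: K_def)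
  have wr: "(\<lambda>n. wk (r n)) \<longlonglongrightarrow> w" and yr: "(\<lambda>n. yk (r n)) \<longlonglongrightarrow> ys"
    and pr: "(\<lambda>n. L (yk (r n) /\<^sub>R t (r n))) \<longlonglongrightarrow> p"
    using LIMSEQ_subseq_LIMSEQ[OF wk r(1)] LIMSEQ_subseq_LIMSEQ[OF yk r(1)]
      LIMSEQ_subseq_LIMSEQ[OF p r(1)] by (auto simp: o_def)
  \<comment> \<open>Each element of \<open>K\<close> is a regular normal at all points
    \<open>wk (r n)\<close>, which tend to \<open>w\<close>, so a constant sequence of normals is
    enough.\<close>
  have sub: "K \<subseteq> lim_normal_cone ?T w"
  proof
    fix \<eta> assume "\<eta> \<in> K"
    then have "\<forall>n. \<eta> \<in> reg_normal_cone ?T (wk (r n))" using r(2) by (simp add: K_def)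
    then show "\<eta> \<in> lim_normal_cone ?T w"
      unfolding lim_normal_cone_def mem_Collect_eq
      by (intro exI[of _ "\<lambda>n. wk (r n)"] exI[of _ "\<lambda>_. \<eta>"]) (use wr wT in auto)
  qed
  have ysK: "ys \<in> K"
    by (rule closed_sequentially[OF polyhedron_imp_closed[OF K(1)] yK yr])
  obtain F where F: "finite F" "K = convex_cone hull F"
    using polyhedral_cone_finitely_generated[OF K] by blast
  have "closed (L ` K)" unfolding F(2) by (rule closed_linear_image_convex_cone_hull[OF L F(1)])
  moreover have "L (yk (r n) /\<^sub>R t (r n)) \<in> L ` K" for n
    using convex_cone_scaleR[OF K(2) _ yK[of n], of "inverse (t (r n))"] t[of "r n"] by simp
  ultimately have "p \<in> L ` K" by (rule closed_sequentially[OF _ _ pr])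
  then show "\<exists>z1 \<in> lim_normal_cone ?T w. L z1 = p" using sub by blast
  define R where "R = convex_cone hull (insert (- ys) F)"
  have "closed (L ` R)"
    unfolding R_def by (rule closed_linear_image_convex_cone_hull[OF L]) (use F in simp)
  \<comment> \<open>Since \<open>L ys = 0\<close>, subtracting \<open>ys\<close> does not change the
    image, while the quotient of \<open>yk (r n) - ys\<close> lies in \<open>R\<close>.\<close>
  moreover have "L (yk (r n) /\<^sub>R t (r n)) \<in> L ` R" for n
  proof -
    have "K \<subseteq> R" unfolding R_def F(2) by (rule hull_mono) blast
    then have "yk (r n) \<in> R" using yK by blast
    moreover have "- ys \<in> R" unfolding R_def by (rule hull_inc) simp
    ultimately have "inverse (t (r n)) *\<^sub>R (yk (r n) + - ys) \<in> R"
      unfolding R_def using t[of "r n"] by (intro convex_cone_hull_mul convex_cone_hull_add) auto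
    moreover have "L (inverse (t (r n)) *\<^sub>R (yk (r n) + - ys)) = L (yk (r n) /\<^sub>R t (r n))"
      using L Lys by (simp add: linear_scale linear_diff)
    ultimately show ?thesis by (metis imageI)
  qed
  ultimately have "p \<in> L ` R" by (rule closed_sequentially[OF _ _ pr])
  moreover have "R \<subseteq> tan_cone K ys"
  proof -
    have "F \<subseteq> K" unfolding F(2) by (rule hull_subset)
    then have "R \<subseteq> convex_cone hull (insert (- ys) K)" unfolding R_def by (intro hull_mono) blast
    then show ?thesis using convex_cone_hull_insert_minus_subset_tan_cone[OF K(2) ysK] by blast
  qed
  ultimately show "\<exists>z2 \<in> tan_cone (lim_normal_cone ?T w) ys. L z2 = p"
    using tan_cone_mono[OF sub, of ys] by blast
qed

section \<open>Existence of multipliers for the second order pseudo-coderivative\<close>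

text \<open>The vector \<open>hess\<close> is the Hessian of the scalar function
  \<open>ys \<bullet> g x\<close> at \<open>xb\<close> applied to \<open>u\<close>: its inner
  product with \<open>h\<close> is \<open>ys \<bullet> g'' xb u h\<close>. Condition (b) does not
  involve the multiplier and is therefore stated once for all of them.\<close>

theorem theorem3p2:
  fixes g :: "'a::euclidean_space \<Rightarrow> 'b::euclidean_space"
    and g' :: "'a \<Rightarrow> ('a \<Rightarrow>\<^sub>L 'b)"
    and g'' :: "'a \<Rightarrow> ('a \<Rightarrow>\<^sub>L ('a \<Rightarrow>\<^sub>L 'b))"
    and D :: "'b set" and xb u :: 'a and v ys :: 'b and xs :: 'a
  assumes g1: "\<And>x. (g has_derivative blinfun_apply (g' x)) (at x)"
    and g2: "\<And>x. (g' has_derivative blinfun_apply (g'' x)) (at x)"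
    and g2c: "continuous_on UNIV g''"
    and Dclosed: "closed D"
    and gph: "(xb, 0) \<in> {(x, y). y \<in> (\<lambda>d. g x - d) ` D}"
    and u: "u \<in> sphere 0 1"
    and xs: "xs \<in> pseudo_coderiv2 {(x, y). y \<in> (\<lambda>d. g x - d) ` D} (xb, 0) (u, v) ys"
  defines "w \<equiv> g' xb u - v"
    and "hess \<equiv> adjoint (\<lambda>h. g'' xb u h) ys"
    and "gT \<equiv> adjoint (blinfun_apply (g' xb))"
  shows "(\<exists>zs. xs = hess + gT zs)
     \<and> ys \<in> dir_normal_cone D (g xb) w \<and> gT ys = 0
     \<and> ((graph_deriv_normal D (g xb) ys 0 \<inter> {z. gT z = 0} = {0}
          \<or> (w \<noteq> 0 \<and> graph_subderiv_normal D (g xb) ys (w /\<^sub>R norm w) \<inter> {z. gT z = 0} = {}))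
        \<longrightarrow> (\<exists>zs \<in> graph_deriv_normal D (g xb) ys w. xs = hess + gT zs))
     \<and> (locally_polyhedral D (g xb) \<longrightarrow>
          dir_normal_cone D (g xb) w = lim_normal_cone (tan_cone D (g xb)) w
          \<and> (\<exists>z1 z2. xs = hess + gT z1 \<and> xs = hess + gT z2
               \<and> z1 \<in> lim_normal_cone (tan_cone D (g xb)) w
               \<and> z2 \<in> tan_cone (lim_normal_cone (tan_cone D (g xb)) w) ys))"
proof -
  have nu: "norm u = 1" using u by simp
  obtain t :: "nat \<Rightarrow> real" and wk yk where t: "\<And>k. t k > 0" "t \<longlonglongrightarrow> 0"
    and wk: "wk \<longlonglongrightarrow> w" and yk: "yk \<longlonglongrightarrow> ys"
    and N: "\<And>k. yk k \<in> reg_normal_cone D (g xb + t k *\<^sub>R wk k)"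
    and gys: "gT ys = 0" and lim: "(\<lambda>k. gT (yk k /\<^sub>R t k)) \<longlonglongrightarrow> xs - hess"
    unfolding w_def hess_def gT_def
    by (rule pseudo_coderiv2_diff_sequences[OF g1 g2 nu xs]) blast
  have L: "linear gT"
    unfolding gT_def by (simp add: adjoint_linear blinfun.bounded_linear_right bounded_linear.linear)
  have "closed (range gT)"
    by (rule closed_subspace) (rule linear_subspace_image[OF L subspace_UNIV])
  then have "xs - hess \<in> range gT"
    by (rule closed_sequentially[OF _ _ lim]) simp
  then obtain zs where "xs - hess = gT zs" by blast
  then have a: "\<exists>zs. xs = hess + gT zs" by (metis add.commute diff_add_cancel)
  have b: "ys \<in> dir_normal_cone D (g xb) w"
    unfolding dir_normal_cone_def using t wk yk N by blast
  have i: "\<exists>zs \<in> graph_deriv_normal D (g xb) ys w. xs = hess + gT zs"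
    if qual: "graph_deriv_normal D (g xb) ys 0 \<inter> {z. gT z = 0} = {0}
          \<or> (w \<noteq> 0 \<and> graph_subderiv_normal D (g xb) ys (w /\<^sub>R norm w) \<inter> {z. gT z = 0} = {})"
  proof -
    \<comment> \<open>As \<open>gT ys = 0\<close>, the quotients may be centred at
      \<open>ys\<close>, which is the form a tangent to the graph requires.\<close>
    have "(\<lambda>k. gT ((yk k - ys) /\<^sub>R t k)) \<longlonglongrightarrow> xs - hess"
      using lim gys by (simp add: linear_scale[OF L] linear_diff[OF L])
    moreover have "yk k \<in> lim_normal_cone D (g xb + t k *\<^sub>R wk k)" for k
      using N reg_normal_cone_subset_lim_normal_cone by blast
    ultimately obtain z where "z \<in> graph_deriv_normal D (g xb) ys w" "gT z = xs - hess"
      using graph_deriv_normal_limit[OF L t wk yk _ _ qual] by blast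
    then show ?thesis by (intro bexI[of _ z]) auto
  qed
  have ii: "dir_normal_cone D (g xb) w = lim_normal_cone (tan_cone D (g xb)) w
          \<and> (\<exists>z1 z2. xs = hess + gT z1 \<and> xs = hess + gT z2
               \<and> z1 \<in> lim_normal_cone (tan_cone D (g xb)) w
               \<and> z2 \<in> tan_cone (lim_normal_cone (tan_cone D (g xb)) w) ys)"
    if "locally_polyhedral D (g xb)"
  proof -
    obtain Q where Q: "finite Q" "\<forall>S\<in>Q. polyhedron S" and T: "tan_cone D (g xb) = \<Union>Q"
      and con: "conic (tan_cone D (g xb))"
      and ev: "eventually (\<lambda>h. g xb + h \<in> D \<longleftrightarrow> h \<in> tan_cone D (g xb)) (nhds 0)"
      using locally_polyhedral_tan_cone[OF \<open>locally_polyhedral D (g xb)\<close>] by blast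
    obtain r where r: "r > 0" "\<And>t w. t > 0 \<Longrightarrow> norm (t *\<^sub>R w) < r \<Longrightarrow>
        reg_normal_cone D (g xb + t *\<^sub>R w) = reg_normal_cone (tan_cone D (g xb)) w"
      using reg_normal_cone_eq_local_cone[OF con ev] by blast
    \<comment> \<open>Normals to \<open>D\<close> and to its tangent cone are known to agree only
      within radius \<open>r\<close>, so the sequences are cut at an index \<open>M\<close> beyond
      which all steps are shorter.\<close>
    have "(\<lambda>k. norm (t k *\<^sub>R wk k)) \<longlonglongrightarrow> norm (0 *\<^sub>R w)" by (intro tendsto_intros t wk)
    then have "eventually (\<lambda>k. norm (t k *\<^sub>R wk k) < r) sequentially"
      by (rule order_tendstoD) (use r in simp)
    then obtain M where M: "\<And>k. k \<ge> M \<Longrightarrow> norm (t k *\<^sub>R wk k) < r"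
      unfolding eventually_sequentially by blast
    have "yk (k + M) \<in> reg_normal_cone (\<Union>Q) (wk (k + M))" for k
      using r(2)[OF t(1) M, of "k + M"] N[of "k + M"] by (simp add: T)
    note mult = polyhedral_multipliers[OF Q L t(1) LIMSEQ_ignore_initial_segment[OF wk, of M]
        LIMSEQ_ignore_initial_segment[OF yk, of M] this gys
        LIMSEQ_ignore_initial_segment[OF lim, of M], folded T]
    obtain z1 z2 where z: "z1 \<in> lim_normal_cone (tan_cone D (g xb)) w" "gT z1 = xs - hess"
      "z2 \<in> tan_cone (lim_normal_cone (tan_cone D (g xb)) w) ys" "gT z2 = xs - hess"
      using mult by blast
    then have "xs = hess + gT z1" "xs = hess + gT z2" by simp_all
    then show ?thesis using dir_normal_cone_local_cone[OF con ev] z(1,3) by blast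
  qed
  show ?thesis using a b gys i ii by blast
qed

end
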